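(* Let $(X,d)$ be a complete metric space and let $F\subset X$ be compact and purely $1$-unrectifiable, such that for some $r_0>0$ and $C\geq1$, $$\frac1C r\leq\mathcal{H}^1(F\cap B(x,r))\leq Cr\qquad\text{for all } 0<r<r_0,\ x\in F.$$ Then for any $\varepsilon,\delta>0$ and $R\geq1$ there exists a finite collection of Besicovitch partitions $P_i=(F_{i,1},F_{i,2},\omega_i,p_{i,1},p_{i,2})$ of $F$, $1\leq i\leq n$, such that: (P1) $P_i$ and $P_j$ are $R$-disjoint for all $1\leq i\neq j\leq n$; (P2) $\omega_i<\delta$ for each $1\leq i\leq n$; (P3) $\displaystyle\sum_{1\leq i\leq n}\omega_i>\frac{1-\varepsilon}{3(2R+1)}\mathcal{H}^1(F)$.
   Context: $B(x,r)$ denotes the closed ball of centre $x$ and radius $r>0$. Hausdorff measure: $\mathcal{H}^1(E)=\lim_{\delta\to0}\inf\{\sum_i \mathrm{diam}(A_i): E\subset\bigcup_i A_i,\ \mathrm{diam}(A_i)<\delta\}$. A set $E\subset X$ is $1$-rectifiable if there are at most countably many Lipschitz maps $f_i:A_i\to X$, $A_i\subset\mathbb{R}$, with $\mathcal{H}^1(E\setminus\bigcup_i f_i(A_i))=0$; a set $P\subset X$ is purely $1$-unrectifiable if $\mathcal{H}^1(P\cap E)=0$ for every $1$-rectifiable $E\subset X$. A Besicovitch partition of a set $E\subset X$ is a tuple $P=(E_1,E_2,\omega,p_1,p_2)$ where $E=E_1\cup E_2$ is a partition of $E$, $0<\omega=\mathrm{dist}(E_1,E_2)$ (the infimum of distances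 between points of $E_1$ and points of $E_2$), and $p_1\in E_1$, $p_2\in E_2$ are points with $d(p_1,p_2)=\omega$. Two Besicovitch partitions $P=(E_1,E_2,\omega,p_1,p_2)$ and $P'=(E_1',E_2',\omega',p_1',p_2')$ are $R$-disjoint if $B(p_i,R\omega)\cap B(p_j',R\omega')=\emptyset$ for all $i,j\in\{1,2\}$.
   Formalization: The set F is additionally assumed to be nonempty; for F empty the hypotheses hold but there are no Besicovitch partitions of F, so (P3) would read 0 > 0 and the claim fails. *)

theory Defs
  imports "HOL-Analysis.Analysis"
begin

text \<open>
  The library value \<^term>\<open>diameter S\<close> is a real number and carries no information when \<open>S\<close>
  is unbounded, so boundedness is demanded of covering sets explicitly; in the mathematical
  definition it is implied by the finite bound on the diameters. Finite covers are included,
  since covering sets may be empty and the diameter of the empty set is \<open>0\<close>.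
\<close>

definition hausdorff1_pre :: "real \<Rightarrow> 'a::metric_space set \<Rightarrow> ennreal" where
  "hausdorff1_pre \<delta> E =
     (INF A \<in> {A :: nat \<Rightarrow> 'a set. E \<subseteq> (\<Union>i. A i) \<and> (\<forall>i. bounded (A i) \<and> diameter (A i) < \<delta>)}.
        \<Sum>i. ennreal (diameter (A i)))"

definition hausdorff1 :: "'a::metric_space set \<Rightarrow> ennreal" where
  "hausdorff1 E = Lim (at_right 0) (\<lambda>\<delta>. hausdorff1_pre \<delta> E)"

lemma hausdorff1_pre_antimono:
  "\<delta> \<le> \<delta>' \<Longrightarrow> hausdorff1_pre \<delta>' E \<le> hausdorff1_pre \<delta> E"
  unfolding hausdorff1_pre_def
  by (rule INF_superset_mono) (auto intro: less_le_trans)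

text \<open>The limit in the definition of \<^const>\<open>hausdorff1\<close> always exists.\<close>

lemma tendsto_hausdorff1_pre_SUP:
  "((\<lambda>\<delta>. hausdorff1_pre \<delta> E) \<longlongrightarrow> (SUP \<delta>\<in>{0<..}. hausdorff1_pre \<delta> E)) (at_right 0)"
proof (rule order_tendstoI)
  fix a assume "a < (SUP \<delta>\<in>{0<..}. hausdorff1_pre \<delta> E)"
  then obtain d where d: "d > 0" "a < hausdorff1_pre d E"
    by (auto simp: less_SUP_iff)
  then have "a < hausdorff1_pre \<delta> E" if "\<delta> < d" for \<delta>
    using hausdorff1_pre_antimono[of \<delta> d E] that by (meson less_imp_le less_le_trans)
  then show "\<forall>\<^sub>F \<delta> in at_right 0. a < hausdorff1_pre \<delta> E"
    using d(1) unfolding eventually_at_right_field by blast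
next
  fix a assume a: "(SUP \<delta>\<in>{0<..}. hausdorff1_pre \<delta> E) < a"
  have "hausdorff1_pre \<delta> E < a" if "\<delta> > 0" for \<delta>
    using a that by (meson SUP_lessD greaterThan_iff)
  then show "\<forall>\<^sub>F \<delta> in at_right 0. hausdorff1_pre \<delta> E < a"
    unfolding eventually_at_right_field by (meson zero_less_one)
qed

lemma hausdorff1_eq_SUP: "hausdorff1 E = (SUP \<delta>\<in>{0<..}. hausdorff1_pre \<delta> E)"
  unfolding hausdorff1_def
  by (rule tendsto_Lim[OF _ tendsto_hausdorff1_pre_SUP]) simp

lemma tendsto_hausdorff1: "((\<lambda>\<delta>. hausdorff1_pre \<delta> E) \<longlongrightarrow> hausdorff1 E) (at_right 0)"
  using tendsto_hausdorff1_pre_SUP by (simp add: hausdorff1_eq_SUP)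

text \<open>Fewer than countably infinitely many maps are covered by taking \<open>A i = {}\<close>.\<close>

definition rectifiable1 :: "'a::metric_space set \<Rightarrow> bool" where
  "rectifiable1 E \<longleftrightarrow>
     (\<exists>(A :: nat \<Rightarrow> real set) (f :: nat \<Rightarrow> real \<Rightarrow> 'a).
        (\<forall>i. \<exists>L. L-lipschitz_on (A i) (f i)) \<and> hausdorff1 (E - (\<Union>i. f i ` A i)) = 0)"

definition purely_unrectifiable1 :: "'a::metric_space set \<Rightarrow> bool" where
  "purely_unrectifiable1 P \<longleftrightarrow> (\<forall>E. rectifiable1 E \<longrightarrow> hausdorff1 (P \<inter> E) = 0)"

record 'a bpartition =
  part1 :: "'a set"
  part2 :: "'a set"
  gap :: real
  pt1 :: 'a
  pt2 :: 'a

text \<open>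
  Both parts are nonempty because they contain \<open>pt1\<close> and \<open>pt2\<close>; hence \<^const>\<open>setdist\<close>, which is
  \<open>0\<close> by convention when a set is empty, is the genuine infimum of distances here.
\<close>

definition besicovitch_partition :: "'a::metric_space set \<Rightarrow> 'a bpartition \<Rightarrow> bool" where
  "besicovitch_partition E P \<longleftrightarrow>
     E = part1 P \<union> part2 P \<and> part1 P \<inter> part2 P = {} \<and>
     0 < gap P \<and> gap P = setdist (part1 P) (part2 P) \<and>
     pt1 P \<in> part1 P \<and> pt2 P \<in> part2 P \<and> dist (pt1 P) (pt2 P) = gap P"

definition R_disjoint :: "real \<Rightarrow> 'a::metric_space bpartition \<Rightarrow> 'a bpartition \<Rightarrow> bool" where
  "R_disjoint R P P' \<longleftrightarrow>
     (\<forall>p\<in>{pt1 P, pt2 P}. \<forall>p'\<in>{pt1 P', pt2 P'}.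
        cball p (R * gap P) \<inter> cball p' (R * gap P') = {})"

end

theory Submission
  imports Defs
begin

text \<open>
  Choose \<open>R\<close>-disjoint Besicovitch partitions greedily by decreasing gap, among those with gap
  below a small \<open>\<delta>\<close>, and suppose that the gaps \<open>\<omega> i\<close> sum to at most \<open>(1 - \<epsilon>) / (3 * (2 * R + 1))\<close>
  times the measure of \<open>F\<close>. Balls of radius \<open>b * \<omega> i\<close> about one point \<open>p i\<close> of each partition, where
  \<open>b = 3 * R + 3 / 2\<close>, have diameters summing to at most \<open>1 - \<epsilon>\<close> times that measure, so for small
  \<open>\<delta>\<close> what they leave of \<open>F\<close> has positive measure. This remainder is rectifiable, against pure
  unrectifiability. By Tychonoff it is enough to visit each of its finite subsets by a tour of
  bounded length. The tour runs along a spanning tree built from the short edges of an \<open>\<eta>\<close>-net of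
  \<open>F\<close>, whose total length is bounded by Ahlfors regularity, and, for each \<open>i\<close>, from edges joining \<open>p i\<close>
  to everything (net points and smaller balls) that meets the sphere of some radius
  \<open>s i \<in> {(2 * R + 2) * \<omega> i..b * \<omega> i}\<close> about \<open>p i\<close>. A discrete coarea argument gives a radius for
  which the number of these edges is bounded by a constant. By the greedy choice both end points of
  any remaining gap below \<open>\<delta>\<close> lie in one of the balls of radius \<open>s i\<close>, which the graph contracts
  to a point; hence only the finitely many components of \<open>F\<close> at scale \<open>\<delta>\<close> are left to be joined.
\<close>

subsection \<open>Hausdorff measure\<close>

lemma hausdorff1_pre_mono: "E \<subseteq> E' \<Longrightarrow> hausdorff1_pre \<delta> E \<le> hausdorff1_pre \<delta> E'"
  unfolding hausdorff1_pre_def by (rule INF_superset_mono) auto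

lemma hausdorff1_mono: "E \<subseteq> E' \<Longrightarrow> hausdorff1 E \<le> hausdorff1 E'"
  unfolding hausdorff1_eq_SUP by (rule SUP_mono) (auto intro: hausdorff1_pre_mono)

lemma hausdorff1_pre_le_hausdorff1: "\<delta> > 0 \<Longrightarrow> hausdorff1_pre \<delta> E \<le> hausdorff1 E"
  unfolding hausdorff1_eq_SUP by (rule SUP_upper) auto

lemma hausdorff1_pre_le:
  assumes "E \<subseteq> (\<Union>i. A i)" "\<And>i. bounded (A i)" "\<And>i. diameter (A i) < \<delta>"
  shows "hausdorff1_pre \<delta> E \<le> (\<Sum>i. ennreal (diameter (A i)))"
  unfolding hausdorff1_pre_def using assms by (intro INF_lower) auto

lemma hausdorff1_pre_le_diameter:
  assumes "bounded E" "diameter E < \<delta>"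
  shows "hausdorff1_pre \<delta> E \<le> ennreal (diameter E)"
proof -
  have "\<delta> > 0" using assms diameter_ge_0 by fastforce
  have "hausdorff1_pre \<delta> E \<le> (\<Sum>i::nat. ennreal (diameter (if i = 0 then E else {})))"
    by (rule hausdorff1_pre_le) (use assms \<open>\<delta> > 0\<close> in \<open>auto simp: diameter_empty split: if_splits\<close>)
  also have "\<dots> = (\<Sum>i\<in>{0::nat}. ennreal (diameter (if i = 0 then E else {})))"
    by (rule suminf_finite) (auto simp: diameter_empty)
  finally show ?thesis by simp
qed

lemma hausdorff1_pre_empty: "\<delta> > 0 \<Longrightarrow> hausdorff1_pre \<delta> {} = 0"
  using hausdorff1_pre_le_diameter[of "{}" \<delta>] by (simp add: diameter_empty)

text \<open>Covers that are optimal up to \<open>e * (1/2) ^ Suc n\<close> are merged into one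
  sequence by the pairing \<open>prod_decode\<close>; the errors add up to \<open>e\<close>.\<close>

lemma hausdorff1_pre_UN_le:
  "hausdorff1_pre \<delta> (\<Union>n. E n) \<le> (\<Sum>n. hausdorff1_pre \<delta> (E n))"
proof (rule ennreal_le_epsilon)
  fix e :: real
  assume e: "0 < e" and fin: "(\<Sum>n. hausdorff1_pre \<delta> (E n)) < top"
  have "\<exists>A. E n \<subseteq> (\<Union>i. A i) \<and> (\<forall>i. bounded (A i) \<and> diameter (A i) < \<delta>) \<and>
      (\<Sum>i. ennreal (diameter (A i))) \<le> hausdorff1_pre \<delta> (E n) + ennreal (e * (1/2) ^ Suc n)" for n
  proof -
    \<comment> \<open>Only for a finite value does adding a positive error give something strictly
      larger, and hence a cover below it.\<close>
    have "hausdorff1_pre \<delta> (E n) \<noteq> top"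
      using fin by (metis ennreal_suminf_lessD less_irrefl)
    then have "hausdorff1_pre \<delta> (E n) < hausdorff1_pre \<delta> (E n) + ennreal (e * (1/2) ^ Suc n)"
      using e by (simp add: ennreal_zero_less_mult_iff)
    then show ?thesis
      unfolding hausdorff1_pre_def[of \<delta> "E n"] INF_less_iff by (auto intro: less_imp_le)
  qed
  then obtain A where A: "\<And>n. E n \<subseteq> (\<Union>i. A n i)" "\<And>n i. bounded (A n i)"
      "\<And>n i. diameter (A n i) < \<delta>"
      "\<And>n. (\<Sum>i. ennreal (diameter (A n i))) \<le> hausdorff1_pre \<delta> (E n) + ennreal (e * (1/2) ^ Suc n)"
    by metis
  define B where "B k = (case prod_decode k of (n, i) \<Rightarrow> A n i)" for k
  have "hausdorff1_pre \<delta> (\<Union>n. E n) \<le> (\<Sum>k. ennreal (diameter (B k)))"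
  proof (rule hausdorff1_pre_le)
    show "(\<Union>n. E n) \<subseteq> (\<Union>k. B k)"
    proof
      fix x assume "x \<in> (\<Union>n. E n)"
      then obtain n i where "x \<in> A n i" using A(1) by blast
      then have "x \<in> B (prod_encode (n, i))" by (simp add: B_def)
      then show "x \<in> (\<Union>k. B k)" by blast
    qed
  qed (auto simp: B_def A split: prod.split)
  also have "\<dots> = (\<Sum>n i. ennreal (diameter (A n i)))"
  proof -
    have "(\<Sum>k. (\<lambda>(n, i). ennreal (diameter (A n i))) (prod_decode k)) =
        (\<Sum>n. \<Sum>i. ennreal (diameter (A n i)))"
      using suminf_ennreal_2dimen[of "\<lambda>n. \<Sum>i. ennreal (diameter (A n i))"
          "\<lambda>(n, i). ennreal (diameter (A n i))"]
      by (simp add: comp_def)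
    then show ?thesis by (simp add: B_def case_prod_unfold)
  qed
  also have "\<dots> \<le> (\<Sum>n. hausdorff1_pre \<delta> (E n) + ennreal (e * (1/2) ^ Suc n))"
    by (rule suminf_le) (use A(4) in auto)
  also have "\<dots> = (\<Sum>n. hausdorff1_pre \<delta> (E n)) + (\<Sum>n. ennreal (e * (1/2) ^ Suc n))"
    by (simp add: suminf_add)
  also have "(\<Sum>n. ennreal (e * (1/2) ^ Suc n)) = ennreal e"
  proof (rule suminf_ennreal_eq)
    show "(\<lambda>n. e * (1/2) ^ Suc n) sums e"
      using sums_mult[OF power_half_series, of e] by (simp only: mult_1_right)
  qed (use e in simp)
  finally show "hausdorff1_pre \<delta> (\<Union>n. E n) \<le> (\<Sum>n. hausdorff1_pre \<delta> (E n)) + ennreal e" .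
qed

lemma hausdorff1_pre_Un_le:
  assumes "\<delta> > 0"
  shows "hausdorff1_pre \<delta> (A \<union> B) \<le> hausdorff1_pre \<delta> A + hausdorff1_pre \<delta> B"
proof -
  define E where "E n = (if n = 0 then A else if n = 1 then B else {})" for n :: nat
  have "hausdorff1_pre \<delta> (A \<union> B) \<le> hausdorff1_pre \<delta> (\<Union>n. E n)"
    by (rule hausdorff1_pre_mono) (auto simp: E_def split: if_splits)
  also have "\<dots> \<le> (\<Sum>n. hausdorff1_pre \<delta> (E n))" by (rule hausdorff1_pre_UN_le)
  also have "\<dots> = (\<Sum>n\<in>{0,1}. hausdorff1_pre \<delta> (E n))"
    by (rule suminf_finite) (auto simp: E_def hausdorff1_pre_empty assms)
  finally show ?thesis by (simp add: E_def)
qed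

lemma hausdorff1_Un_le: "hausdorff1 (A \<union> B) \<le> hausdorff1 A + hausdorff1 B"
  unfolding hausdorff1_eq_SUP[of "A \<union> B"]
  by (rule SUP_least)
    (meson add_mono greaterThan_iff hausdorff1_pre_Un_le hausdorff1_pre_le_hausdorff1 order_trans)

lemma hausdorff1_empty: "hausdorff1 {} = 0"
  by (simp add: hausdorff1_eq_SUP hausdorff1_pre_empty)

lemma hausdorff1_UN_finite_le:
  "finite I \<Longrightarrow> hausdorff1 (\<Union>i\<in>I. E i) \<le> (\<Sum>i\<in>I. hausdorff1 (E i))"
proof (induction I rule: finite_induct)
  case (insert i I)
  then show ?case
    using hausdorff1_Un_le[of "E i" "\<Union>i\<in>I. E i"] by (simp add: add_left_mono order_trans)
qed (simp add: hausdorff1_empty)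

text \<open>A covering set of diameter below \<open>\<delta>\<close> cannot meet both
  \<open>A\<close> and \<open>B\<close>, so every admissible cover of the union splits into a cover
  of each.\<close>

lemma hausdorff1_pre_Un_ge:
  assumes "\<And>x y. x \<in> A \<Longrightarrow> y \<in> B \<Longrightarrow> dist x y \<ge> \<delta>"
  shows "hausdorff1_pre \<delta> A + hausdorff1_pre \<delta> B \<le> hausdorff1_pre \<delta> (A \<union> B)"
  unfolding hausdorff1_pre_def[of \<delta> "A \<union> B"]
proof (rule INF_greatest)
  fix U :: "nat \<Rightarrow> 'a set"
  assume "U \<in> {U. A \<union> B \<subseteq> (\<Union>i. U i) \<and> (\<forall>i. bounded (U i) \<and> diameter (U i) < \<delta>)}"
  then have U: "A \<union> B \<subseteq> (\<Union>i. U i)" "\<And>i. bounded (U i)" "\<And>i. diameter (U i) < \<delta>" by auto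
  have \<delta>: "\<delta> > 0" using U(2)[of 0] U(3)[of 0] diameter_ge_0 by fastforce
  \<comment> \<open>Sets that miss \<open>E\<close> are made empty instead of being dropped: the
    index set stays the same and they contribute diameter \<open>0\<close>.\<close>
  define V where "V E i = (if U i \<inter> E = {} then {} else U i)" for E i
  have V: "hausdorff1_pre \<delta> E \<le> (\<Sum>i. ennreal (diameter (V E i)))" if "E \<subseteq> (\<Union>i. U i)" for E
    by (rule hausdorff1_pre_le) (use U \<delta> that in \<open>force simp: V_def diameter_empty\<close>)+
  have "ennreal (diameter (V A i)) + ennreal (diameter (V B i)) \<le> ennreal (diameter (U i))" for i
  proof (cases "U i \<inter> A = {} \<or> U i \<inter> B = {}")
    case False
    then obtain x y where "x \<in> U i" "x \<in> A" "y \<in> U i" "y \<in> B" by auto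
    then show ?thesis
      using assms[of x y] diameter_bounded_bound[OF U(2)[of i], of x y] U(3)[of i] by simp
  qed (auto simp: V_def diameter_empty)
  then have "(\<Sum>i. ennreal (diameter (V A i)) + ennreal (diameter (V B i))) \<le>
      (\<Sum>i. ennreal (diameter (U i)))"
    by (intro suminf_le) auto
  moreover have "(\<Sum>i. ennreal (diameter (V A i)) + ennreal (diameter (V B i))) =
      (\<Sum>i. ennreal (diameter (V A i))) + (\<Sum>i. ennreal (diameter (V B i)))"
    by (simp add: suminf_add)
  ultimately show "hausdorff1_pre \<delta> A + hausdorff1_pre \<delta> B \<le> (\<Sum>i. ennreal (diameter (U i)))"
    using V[of A] V[of B] U(1) by (metis (no_types, lifting) add_mono le_sup_iff order_trans)
qed

text \<open>The previous inequality as \<open>\<delta>\<close> tends to \<open>0\<close>. It stands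
  in for measurability in the packing arguments, which involve only pairwise disjoint compact
  sets.\<close>

lemma hausdorff1_Un_ge:
  assumes d: "d > 0" "\<And>x y. x \<in> A \<Longrightarrow> y \<in> B \<Longrightarrow> dist x y \<ge> d"
  shows "hausdorff1 A + hausdorff1 B \<le> hausdorff1 (A \<union> B)"
proof (rule tendsto_le)
  show "((\<lambda>\<delta>. hausdorff1_pre \<delta> A + hausdorff1_pre \<delta> B) \<longlongrightarrow> hausdorff1 A + hausdorff1 B) (at_right 0)"
    by (intro tendsto_add tendsto_hausdorff1)
  show "((\<lambda>\<delta>. hausdorff1_pre \<delta> (A \<union> B)) \<longlongrightarrow> hausdorff1 (A \<union> B)) (at_right 0)"
    by (rule tendsto_hausdorff1)
  have "\<forall>\<^sub>F \<delta> in at_right 0. \<delta> < d"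
    using d(1) unfolding eventually_at_right_field by blast
  then show "\<forall>\<^sub>F \<delta> in at_right 0. hausdorff1_pre \<delta> A + hausdorff1_pre \<delta> B \<le> hausdorff1_pre \<delta> (A \<union> B)"
    by eventually_elim (rule hausdorff1_pre_Un_ge, use d(2) in force)
qed simp

lemma compact_disjoint_separated:
  fixes A B :: "'a::metric_space set"
  assumes "compact A" "compact B" "A \<inter> B = {}"
  obtains d where "d > 0" "\<And>x y. x \<in> A \<Longrightarrow> y \<in> B \<Longrightarrow> dist x y \<ge> d"
proof (cases "A = {} \<or> B = {}")
  case True
  then show ?thesis using that[of 1] by auto
next
  case False
  have "\<exists>z\<in>A \<times> B. \<forall>w\<in>A \<times> B. dist (fst z) (snd z) \<le> dist (fst w) (snd w)"
    by (rule continuous_attains_inf)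
      (use assms False in \<open>auto intro!: continuous_intros compact_Times\<close>)
  then obtain z where z: "z \<in> A \<times> B" "\<And>w. w \<in> A \<times> B \<Longrightarrow> dist (fst z) (snd z) \<le> dist (fst w) (snd w)"
    by blast
  show ?thesis
  proof (rule that)
    show "dist (fst z) (snd z) > 0" using z(1) assms(3) by auto
    show "dist (fst z) (snd z) \<le> dist x y" if "x \<in> A" "y \<in> B" for x y
      using z(2)[of "(x, y)"] that by simp
  qed
qed

lemma sum_hausdorff1_disjoint_le:
  assumes "finite I" "\<And>i. i \<in> I \<Longrightarrow> compact (K i)"
    "\<And>i j. i \<in> I \<Longrightarrow> j \<in> I \<Longrightarrow> i \<noteq> j \<Longrightarrow> K i \<inter> K j = {}"
  shows "(\<Sum>i\<in>I. hausdorff1 (K i)) \<le> hausdorff1 (\<Union>i\<in>I. K i)"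
  using assms
proof (induction I rule: finite_induct)
  case (insert i I)
  have "compact (\<Union>i\<in>I. K i)" using insert by (intro compact_UN) auto
  moreover have "K i \<inter> (\<Union>i\<in>I. K i) = {}" using insert(2,5) by blast
  ultimately obtain d where "d > 0" "\<And>x y. x \<in> K i \<Longrightarrow> y \<in> (\<Union>i\<in>I. K i) \<Longrightarrow> dist x y \<ge> d"
    using compact_disjoint_separated insert(4) by (metis insertI1)
  then have "hausdorff1 (K i) + hausdorff1 (\<Union>i\<in>I. K i) \<le> hausdorff1 (K i \<union> (\<Union>i\<in>I. K i))"
    by (rule hausdorff1_Un_ge)
  moreover have "(\<Sum>i\<in>I. hausdorff1 (K i)) \<le> hausdorff1 (\<Union>i\<in>I. K i)"
    using insert.IH insert.prems by auto
  ultimately have "hausdorff1 (K i) + (\<Sum>i\<in>I. hausdorff1 (K i)) \<le> hausdorff1 (K i \<union> (\<Union>i\<in>I. K i))"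
    by (meson add_left_mono order_trans)
  then show ?case using insert(1,2) by simp
qed simp

subsection \<open>Tours and rectifiability\<close>

text \<open>Read \<open>t x\<close> as the time at which a tour of unit speed visits
  \<open>x\<close>. A detour from \<open>u\<close> to \<open>w\<close> and back takes
  \<open>2 * dist u w\<close>: \<open>w\<close> is visited at time \<open>t u + D\<close>, and every
  visit after that of \<open>u\<close> is delayed by \<open>2 * D\<close>.\<close>

lemma expansive_insert:
  fixes t :: "'a::metric_space \<Rightarrow> real"
  assumes t: "\<And>x. x \<in> W \<Longrightarrow> t x \<in> {0..L}" "\<And>x y. x \<in> W \<Longrightarrow> y \<in> W \<Longrightarrow> dist x y \<le> \<bar>t x - t y\<bar>"
    and u: "u \<in> W" and w: "w \<notin> W"
  obtains t' where "\<And>x. x \<in> insert w W \<Longrightarrow> t' x \<in> {0..L + 2 * dist u w}"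
    "\<And>x y. x \<in> insert w W \<Longrightarrow> y \<in> insert w W \<Longrightarrow> dist x y \<le> \<bar>t' x - t' y\<bar>"
proof
  define D where "D = dist u w"
  have D: "D \<ge> 0" by (simp add: D_def)
  define t' where "t' x = (if x = w then t u + D else if t x \<le> t u then t x else t x + 2 * D)" for x
  show "t' x \<in> {0..L + 2 * dist u w}" if "x \<in> insert w W" for x
    using that t(1)[of x] t(1)[OF u] D unfolding t'_def D_def[symmetric] by auto
  have w': "dist w y \<le> \<bar>t' w - t' y\<bar>" if y: "y \<in> W" for y
  proof -
    have "dist w y \<le> D + \<bar>t u - t y\<bar>"
      using t(2)[OF u y] dist_triangle[of w y u] by (simp add: D_def dist_commute)
    moreover have "y \<noteq> w" using y w by blast
    ultimately show ?thesis using D by (auto simp: t'_def abs_if split: if_splits)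
  qed
  have W': "dist x y \<le> \<bar>t' x - t' y\<bar>" if "x \<in> W" "y \<in> W" for x y
  proof -
    have "x \<noteq> w" "y \<noteq> w" using that w by auto
    then have "\<bar>t x - t y\<bar> \<le> \<bar>t' x - t' y\<bar>" using D by (simp add: t'_def)
    then show ?thesis using t(2)[OF that] by linarith
  qed
  show "dist x y \<le> \<bar>t' x - t' y\<bar>" if "x \<in> insert w W" "y \<in> insert w W" for x y
    using that w'[of x] w'[of y] W'[of x y] by (auto simp: dist_commute abs_minus_commute)
qed

text \<open>Doubling a spanning tree: the tree is grown one vertex at a time, each new edge of length
  \<open>l\<close> lengthens the closed tour by \<open>2 * l\<close>.\<close>

lemma expansive_of_connected:
  fixes V :: "'a::metric_space set" and B :: "('a \<times> 'a) set"
  assumes "finite V" "finite B" "v0 \<in> V" "a \<ge> 0"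
    and edge: "\<And>W. v0 \<in> W \<Longrightarrow> W \<subset> V \<Longrightarrow>
      \<exists>u\<in>W. \<exists>w\<in>V - W. dist u w \<le> a \<or> (u, w) \<in> B \<or> (w, u) \<in> B"
  shows "\<exists>t. (\<forall>x\<in>V. t x \<in> {0..2 * ((\<Sum>(x, y)\<in>B. dist x y) + a * card V)}) \<and>
    (\<forall>x\<in>V. \<forall>y\<in>V. dist x y \<le> \<bar>t x - t y\<bar>)"
proof -
  \<comment> \<open>The budget of a partial tree. Only edges of \<open>B\<close> with both ends in
    \<open>W\<close> are charged, so an edge that leaves \<open>W\<close> is still available to pay
    for the next vertex.\<close>
  define c where "c W = (\<Sum>(x, y)\<in>B \<inter> W \<times> W. dist x y) + a * card W" for W
  define good where "good W \<longleftrightarrow> v0 \<in> W \<and> W \<subseteq> V \<and> (\<exists>t. (\<forall>x\<in>W. t x \<in> {0..2 * c W}) \<and>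
      (\<forall>x\<in>W. \<forall>y\<in>W. dist x y \<le> \<bar>t x - t y\<bar>))" for W
  have c0: "c W \<ge> 0" for W
    unfolding c_def using assms(4) by (intro add_nonneg_nonneg sum_nonneg) auto
  have "good {v0}" using c0[of "{v0}"] assms(3)
    by (auto simp: good_def intro!: exI[of _ "\<lambda>_. 0"])
  then obtain W where W: "good W" and max: "\<And>W'. good W' \<Longrightarrow> card W' \<le> card W"
    using ex_has_greatest_nat[of good "{v0}" card "card V + 1"] assms(1)
    by (metis (no_types, lifting) card_mono good_def add.commute le_imp_less_Suc plus_1_eq_Suc)
  have fW: "finite W" using W assms(1) finite_subset good_def by blast
  have "W = V"
  proof (rule ccontr)
    assume "W \<noteq> V"
    then obtain u w where uw: "u \<in> W" "w \<in> V" "w \<notin> W" "dist u w \<le> a \<or> (u, w) \<in> B \<or> (w, u) \<in> B"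
      using edge[of W] W unfolding good_def by blast
    obtain t where t: "\<And>x. x \<in> W \<Longrightarrow> t x \<in> {0..2 * c W}"
        "\<And>x y. x \<in> W \<Longrightarrow> y \<in> W \<Longrightarrow> dist x y \<le> \<bar>t x - t y\<bar>"
      using W unfolding good_def by blast
    obtain t' where t': "\<And>x. x \<in> insert w W \<Longrightarrow> t' x \<in> {0..2 * c W + 2 * dist u w}"
        "\<And>x y. x \<in> insert w W \<Longrightarrow> y \<in> insert w W \<Longrightarrow> dist x y \<le> \<bar>t' x - t' y\<bar>"
      using expansive_insert[OF t uw(1,3)] by blast
    \<comment> \<open>The step to \<open>w\<close> is paid by the share \<open>a\<close> of the new
      vertex, or else by an edge of \<open>B\<close> ending in \<open>w\<close>, which was not
      charged before.\<close>
    have "c W + dist u w \<le> c (insert w W)"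
    proof (cases "dist u w \<le> a")
      case True
      have "(\<Sum>(x, y)\<in>B \<inter> W \<times> W. dist x y) \<le> (\<Sum>(x, y)\<in>B \<inter> insert w W \<times> insert w W. dist x y)"
        using assms(2) by (intro sum_mono2) auto
      then show ?thesis using True uw(3) fW by (simp add: c_def algebra_simps)
    next
      case False
      then obtain e where e: "e \<in> B" "e = (u, w) \<or> e = (w, u)" using uw(4) by blast
      have "(\<Sum>(x, y)\<in>B \<inter> W \<times> W. dist x y) + dist u w = (\<Sum>(x, y)\<in>insert e (B \<inter> W \<times> W). dist x y)"
        using e uw(1,3) assms(2) by (subst sum.insert) (auto simp: dist_commute)
      also have "\<dots> \<le> (\<Sum>(x, y)\<in>B \<inter> insert w W \<times> insert w W. dist x y)"
        using assms(2) e uw(1) by (intro sum_mono2) auto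
      finally show ?thesis using uw(3) fW assms(4) by (simp add: c_def algebra_simps)
    qed
    then have "{0..2 * c W + 2 * dist u w} \<subseteq> {0..2 * c (insert w W)}" by auto
    then have "good (insert w W)"
      using t' W uw(2) unfolding good_def by (intro conjI exI[of _ t']) blast+
    then show False using max[of "insert w W"] uw(3) fW by simp
  qed
  then obtain t where t: "\<And>x. x \<in> V \<Longrightarrow> t x \<in> {0..2 * c V}"
      "\<And>x y. x \<in> V \<Longrightarrow> y \<in> V \<Longrightarrow> dist x y \<le> \<bar>t x - t y\<bar>"
    using W unfolding good_def by blast
  have "(\<Sum>(x, y)\<in>B \<inter> V \<times> V. dist x y) \<le> (\<Sum>(x, y)\<in>B. dist x y)"
    using assms(2) by (intro sum_mono2) auto
  then have "{0..2 * c V} \<subseteq> {0..2 * ((\<Sum>(x, y)\<in>B. dist x y) + a * card V)}"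
    by (auto simp: c_def)
  then show ?thesis using t by (intro exI[of _ t]) blast
qed

text \<open>A time function that works for all of \<open>E\<close> has a 1-Lipschitz inverse with
  image \<open>E\<close>. The functions with values in \<open>{0..L}\<close> form a compact product,
  each pair of points imposes a closed condition, and the hypothesis, with one \<open>L\<close> for
  all \<open>S\<close>, supplies the finite intersection property.\<close>

lemma rectifiable1_of_finite_expansive:
  fixes E :: "'a::metric_space set"
  assumes "L \<ge> 0" and fin: "\<And>S. finite S \<Longrightarrow> S \<subseteq> E \<Longrightarrow>
    \<exists>t. (\<forall>x\<in>S. t x \<in> {0..L}) \<and> (\<forall>x\<in>S. \<forall>y\<in>S. dist x y \<le> \<bar>t x - t y\<bar>)"
  shows "rectifiable1 E"
proof -
  define X where "X = (PiE UNIV (\<lambda>_. {0..L}) :: ('a \<Rightarrow> real) set)"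
  define K where "K z = {t :: 'a \<Rightarrow> real. dist (fst z) (snd z) \<le> \<bar>t (fst z) - t (snd z)\<bar>}" for z
  have "compactin (product_topology (\<lambda>_. euclidean) UNIV) X"
    unfolding X_def compactin_PiE by simp
  then have X: "compact X" by (simp add: euclidean_product_topology)
  have K: "closed (K z)" for z
    unfolding K_def by (intro closed_Collect_le continuous_intros continuous_on_product_coordinates)
  have "X \<inter> \<Inter>(K ` (E \<times> E)) \<noteq> {}"
  proof (rule compact_imp_fip_image[OF X])
    fix Z assume Z: "finite Z" "Z \<subseteq> E \<times> E"
    define S where "S = fst ` Z \<union> snd ` Z"
    have "finite S" "S \<subseteq> E" using Z by (auto simp: S_def)
    then obtain t where t: "\<forall>x\<in>S. t x \<in> {0..L}" "\<forall>x\<in>S. \<forall>y\<in>S. dist x y \<le> \<bar>t x - t y\<bar>"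
      using fin by blast
    \<comment> \<open>The value \<open>0\<close> outside \<open>S\<close> keeps \<open>t'\<close> in
      the product \<open>X\<close>, because \<open>L \<ge> 0\<close>.\<close>
    define t' where "t' x = (if x \<in> S then t x else 0)" for x
    have "t' \<in> X" using t(1) assms(1) by (auto simp: t'_def X_def)
    moreover have "t' \<in> K z" if "z \<in> Z" for z
    proof -
      have "fst z \<in> S" "snd z \<in> S" using that by (auto simp: S_def)
      then show ?thesis using t(2) by (simp add: K_def t'_def)
    qed
    ultimately show "X \<inter> \<Inter>(K ` Z) \<noteq> {}" by blast
  qed (use K in auto)
  then obtain t where t: "\<And>x y. x \<in> E \<Longrightarrow> y \<in> E \<Longrightarrow> dist x y \<le> \<bar>t x - t y\<bar>"
    by (force simp: K_def)
  then have inj: "inj_on t E" by (fastforce intro: inj_onI)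
  have "1-lipschitz_on (t ` E) (inv_into E t)"
    using t inj by (intro lipschitz_onI) (auto simp: dist_real_def)
  then have lip: "\<forall>i::nat. \<exists>L. L-lipschitz_on (t ` E) (inv_into E t)" by blast
  have "E - (\<Union>i::nat. inv_into E t ` t ` E) = {}"
    using inj by (auto simp: image_image)
  then have "hausdorff1 (E - (\<Union>i::nat. inv_into E t ` t ` E)) = 0"
    by (simp only: hausdorff1_empty)
  then show ?thesis
    unfolding rectifiable1_def
    by (intro exI[of _ "\<lambda>_. t ` E"] exI[of _ "\<lambda>_. inv_into E t"]) (use lip in blast)
qed

text \<open>The count at \<open>s\<close> is a sum of indicators of intervals of length
  \<open>2 * \<rho> i\<close>, so its integral over \<open>{a..b}\<close> is at most the right-hand
  side. At some \<open>s\<close> the count does not exceed its mean.\<close>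

lemma averaging:
  fixes d \<rho> :: "'i \<Rightarrow> real" and a b :: real
  assumes "finite I" "a < b" "\<And>i. i \<in> I \<Longrightarrow> \<rho> i \<ge> 0"
  shows "\<exists>s. a \<le> s \<and> s \<le> b \<and> card {i\<in>I. \<bar>d i - s\<bar> \<le> \<rho> i} * (b - a) \<le> (\<Sum>i\<in>I. 2 * \<rho> i)"
proof (rule ccontr)
  assume contra: "\<not> ?thesis"
  define f where "f s = card {i\<in>I. \<bar>d i - s\<bar> \<le> \<rho> i}" for s
  define c where "c = (\<Sum>i\<in>I. 2 * \<rho> i) / (b - a)"
  have cf: "c < f s" if "a \<le> s" "s \<le> b" for s
  proof -
    have "(\<Sum>i\<in>I. 2 * \<rho> i) < f s * (b - a)"
      using contra that unfolding f_def by (meson not_le)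
    then show ?thesis using assms(2) by (simp add: c_def divide_less_eq)
  qed
  \<comment> \<open>Comparing integrals yields only a weak inequality. As the count is an integer,
    it is bounded below by the constant \<open>\<lfloor>c\<rfloor> + 1\<close>, which still exceeds
    \<open>c\<close>.\<close>
  then have f: "of_int (\<lfloor>c\<rfloor> + 1) \<le> real (f s)" if "a \<le> s" "s \<le> b" for s
  proof -
    have "\<lfloor>c\<rfloor> < int (f s)" using cf[OF that] by (simp add: floor_less_iff)
    then show ?thesis by linarith
  qed
  have ind: "(\<Sum>i\<in>I. indicator {d i - \<rho> i..d i + \<rho> i} s :: real) = f s" for s
  proof -
    have "indicator {d i - \<rho> i..d i + \<rho> i} s = (of_bool (\<bar>d i - s\<bar> \<le> \<rho> i) :: real)" for i
      by (auto simp: indicator_def abs_if)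
    then show ?thesis using assms(1) by (simp add: sum_of_bool_eq Int_def f_def)
  qed
  have "(\<integral>s. of_int (\<lfloor>c\<rfloor> + 1) * indicator {a..b} s \<partial>lborel) \<le>
      (\<integral>s. (\<Sum>i\<in>I. indicator {d i - \<rho> i..d i + \<rho> i} s :: real) \<partial>lborel)"
  proof (rule integral_mono)
    show "of_int (\<lfloor>c\<rfloor> + 1) * indicator {a..b} s \<le> (\<Sum>i\<in>I. indicator {d i - \<rho> i..d i + \<rho> i} s :: real)"
      for s unfolding ind using f[of s] by (auto simp: indicator_def)
  qed (auto intro!: integrable_real_indicator Bochner_Integration.integrable_sum integrable_mult_right
      simp: emeasure_lborel_Icc_eq)
  also have "\<dots> = (\<Sum>i\<in>I. 2 * \<rho> i)"
    using assms(3) by (subst Bochner_Integration.integral_sum)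
      (auto intro!: integrable_real_indicator simp: emeasure_lborel_Icc_eq)
  also have "\<dots> = c * (b - a)" using assms(2) by (simp add: c_def)
  finally have "of_int (\<lfloor>c\<rfloor> + 1) * (b - a) \<le> c * (b - a)" using assms(2) by simp
  then have "of_int (\<lfloor>c\<rfloor> + 1) \<le> c" using assms(2) by (simp only: mult_le_cancel_right_pos diff_gt_0_iff_gt)
  then show False by linarith
qed

subsection \<open>Besicovitch partitions and regular sets\<close>

lemma besicovitch_partition_gap_le:
  assumes "besicovitch_partition F P" "x \<in> part1 P" "y \<in> part2 P"
  shows "gap P \<le> dist x y"
  using assms by (auto simp: besicovitch_partition_def intro: setdist_le_dist)

text \<open>A partition whose gap is at least \<open>\<eta>\<close> never separates points closer
  than \<open>\<eta>\<close>. Its parts are therefore determined by which points of a finite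
  \<open>\<eta>\<close>-net lie in the first one.\<close>

lemma finite_gaps:
  fixes F :: "'a::metric_space set"
  assumes "compact F" "\<eta> > 0"
  shows "finite {gap P | P. besicovitch_partition F P \<and> \<eta> \<le> gap P}"
proof -
  obtain N where N: "finite N" "N \<subseteq> F" "F \<subseteq> (\<Union>x\<in>N. ball x \<eta>)"
    using compactE_image[OF assms(1), of F "\<lambda>x. ball x \<eta>"] assms(2) by force
  define near where "near A = {x \<in> F. \<exists>n\<in>A. dist n x < \<eta>}" for A
  have "gap P \<in> (\<lambda>A. setdist (near A) (F - near A)) ` Pow N"
    if P: "besicovitch_partition F P" "\<eta> \<le> gap P" for P
  proof -
    have P': "F = part1 P \<union> part2 P" "part1 P \<inter> part2 P = {}" "gap P = setdist (part1 P) (part2 P)"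
      using P(1) by (auto simp: besicovitch_partition_def)
    have gap: "\<eta> \<le> dist x y" if "x \<in> part1 P" "y \<in> part2 P" for x y
      using besicovitch_partition_gap_le[OF P(1) that] P(2) by simp
    have "near (N \<inter> part1 P) = part1 P"
    proof
      show "near (N \<inter> part1 P) \<subseteq> part1 P"
        using gap P'(1) by (fastforce simp: near_def)
      show "part1 P \<subseteq> near (N \<inter> part1 P)"
      proof
        fix x assume x: "x \<in> part1 P"
        then obtain n where n: "n \<in> N" "dist n x < \<eta>" using N(3) P'(1) by force
        have "n \<notin> part2 P" using gap[OF x, of n] n(2) by (auto simp: dist_commute)
        then show "x \<in> near (N \<inter> part1 P)" using n N(2) P'(1) x by (auto simp: near_def)
      qed
    qed
    moreover have "F - part1 P = part2 P" using P' by blast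
    ultimately have "gap P = setdist (near (N \<inter> part1 P)) (F - near (N \<inter> part1 P))"
      using P'(3) by simp
    then show ?thesis by blast
  qed
  then have "{gap P | P. besicovitch_partition F P \<and> \<eta> \<le> gap P} \<subseteq>
      (\<lambda>A. setdist (near A) (F - near A)) ` Pow N" by blast
  then show ?thesis using N(1) finite_subset by blast
qed

lemma R_disjoint_commute: "R_disjoint R P Q \<longleftrightarrow> R_disjoint R Q P"
  unfolding R_disjoint_def by (metis Int_commute)

lemma not_R_disjoint_self: "gap P \<ge> 0 \<Longrightarrow> R \<ge> 0 \<Longrightarrow> \<not> R_disjoint R P P"
  unfolding R_disjoint_def by (auto simp: not_less)

text \<open>A greedy selection by decreasing gap. It is a well-founded recursion because above any
  positive level only finitely many gaps occur; ties are broken by a well-order.\<close>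

lemma greedy_family:
  fixes F :: "'a::metric_space set"
  assumes "compact F" "R \<ge> 0"
  shows "\<exists>\<P>. (\<forall>P\<in>\<P>. besicovitch_partition F P \<and> gap P < \<delta>) \<and>
    (\<forall>P\<in>\<P>. \<forall>Q\<in>\<P>. P \<noteq> Q \<longrightarrow> R_disjoint R P Q) \<and>
    (\<forall>P. besicovitch_partition F P \<longrightarrow> gap P < \<delta> \<longrightarrow> (\<exists>Q\<in>\<P>. gap P \<le> gap Q \<and> \<not> R_disjoint R P Q))"
proof -
  obtain r :: "('a bpartition \<times> 'a bpartition) set" where r: "well_order_on UNIV r"
    using well_order_on by blast
  \<comment> \<open>The rank of \<open>P\<close>: the number of gap values above its own. Larger
    gaps have smaller rank, so ordering by rank considers them first and is well-founded.\<close>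
  define m where "m P = card {gap Q | Q. besicovitch_partition F Q \<and> gap P < gap Q}"
    for P :: "'a bpartition"
  define S where "S = inv_image (less_than <*lex*> (r - Id)) (\<lambda>P. (m P, P))"
  have S: "(Q, P) \<in> S \<longleftrightarrow> m Q < m P \<or> m Q = m P \<and> (Q, P) \<in> r - Id" for P Q
    by (auto simp: S_def)
  have wf: "wf S"
    unfolding S_def using r by (intro wf_inv_image wf_lex_prod) (auto simp: well_order_on_def)
  \<comment> \<open>An admissible \<open>P\<close> is accepted if it is \<open>R\<close>-disjoint
    from every accepted predecessor. A rejected one therefore conflicts with an accepted
    predecessor, whose gap is at least as large.\<close>
  define g where "g = wfrec S (\<lambda>f P. besicovitch_partition F P \<and> gap P < \<delta> \<and>
    (\<forall>Q. (Q, P) \<in> S \<longrightarrow> f Q \<longrightarrow> R_disjoint R Q P))"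
  have g: "g P \<longleftrightarrow> besicovitch_partition F P \<and> gap P < \<delta> \<and>
      (\<forall>Q. (Q, P) \<in> S \<longrightarrow> g Q \<longrightarrow> R_disjoint R Q P)" for P
    unfolding g_def by (subst wfrec[OF wf]) (simp add: cut_def)
  have total: "(P, Q) \<in> S \<or> (Q, P) \<in> S" if "P \<noteq> Q" for P Q
    using that r by (fastforce simp: S well_order_on_def linear_order_on_def total_on_def)
  \<comment> \<open>Ranks compare gaps correctly because only finitely many gap values lie above a
    positive level; \<open>card\<close> of an infinite set would be \<open>0\<close>.\<close>
  have m: "gap P \<le> gap Q" if "m Q \<le> m P" "besicovitch_partition F P" "besicovitch_partition F Q" for P Q
  proof (rule ccontr)
    assume less: "\<not> gap P \<le> gap Q"
    have "gap Q > 0" using that(3) by (simp add: besicovitch_partition_def)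
    then have "finite {gap Q' | Q'. besicovitch_partition F Q' \<and> gap Q \<le> gap Q'}"
      using finite_gaps[OF assms(1)] by blast
    then have "finite {gap Q' | Q'. besicovitch_partition F Q' \<and> gap Q < gap Q'}"
      by (rule rev_finite_subset) force
    moreover have "{gap Q' | Q'. besicovitch_partition F Q' \<and> gap P < gap Q'} \<subset>
        {gap Q' | Q'. besicovitch_partition F Q' \<and> gap Q < gap Q'}"
      using less that(2) by force
    ultimately have "m P < m Q" unfolding m_def by (rule psubset_card_mono)
    then show False using that(1) by simp
  qed
  show ?thesis
  proof (intro exI[of _ "{P. g P}"] conjI ballI allI impI)
    show "R_disjoint R P Q" if "P \<in> {P. g P}" "Q \<in> {P. g P}" "P \<noteq> Q" for P Q
      using total[OF that(3)] that(1,2) g[of P] g[of Q] R_disjoint_commute by blast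
    show "\<exists>Q\<in>{P. g P}. gap P \<le> gap Q \<and> \<not> R_disjoint R P Q"
      if P: "besicovitch_partition F P" "gap P < \<delta>" for P
    proof (cases "g P")
      case True
      moreover have "gap P > 0" using P(1) by (simp add: besicovitch_partition_def)
      ultimately show ?thesis using not_R_disjoint_self[of P R] assms(2) by auto
    next
      case False
      then obtain Q where Q: "(Q, P) \<in> S" "g Q" "\<not> R_disjoint R Q P" using g[of P] P by blast
      then have "m Q \<le> m P" by (auto simp: S)
      then have "gap P \<le> gap Q" using m[OF _ P(1)] g[of Q] Q(2) by blast
      then show ?thesis using Q(2,3) R_disjoint_commute by blast
    qed
  qed (use g in blast)+
qed

section \<open>Packing bounds for Ahlfors regular sets\<close>

locale regular_compact =
  fixes F :: "'a::metric_space set" and r0 C :: real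
  assumes compact: "compact F" and r0: "r0 > 0" and C: "C \<ge> 1"
    and regular: "\<And>r x. 0 < r \<Longrightarrow> r < r0 \<Longrightarrow> x \<in> F \<Longrightarrow>
      ennreal (1 / C * r) \<le> hausdorff1 (F \<inter> cball x r) \<and> hausdorff1 (F \<inter> cball x r) \<le> ennreal (C * r)"
begin

lemma finite_hausdorff1: "hausdorff1 F < top"
proof -
  obtain N where N: "finite N" "N \<subseteq> F" "F \<subseteq> (\<Union>x\<in>N. ball x (r0 / 2))"
    using compactE_image[OF compact, of F "\<lambda>x. ball x (r0 / 2)"] r0 by force
  have "hausdorff1 F \<le> hausdorff1 (\<Union>x\<in>N. F \<inter> cball x (r0 / 2))"
    using N(3) by (intro hausdorff1_mono) force
  also have "\<dots> \<le> (\<Sum>x\<in>N. hausdorff1 (F \<inter> cball x (r0 / 2)))"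
    by (rule hausdorff1_UN_finite_le[OF N(1)])
  also have "\<dots> \<le> (\<Sum>x\<in>N. ennreal (C * (r0 / 2)))"
    using regular[of "r0 / 2"] N(2) r0 by (intro sum_mono) auto
  also have "\<dots> < top" using N(1) by (simp add: ennreal_mult_less_top of_nat_less_top)
  finally show ?thesis .
qed

text \<open>One ball already has positive measure. This makes \<open>(1 - \<epsilon>)\<close> times
  the measure of \<open>F\<close> strictly smaller than the measure itself.\<close>

lemma hausdorff1_pos: "F \<noteq> {} \<Longrightarrow> hausdorff1 F > 0"
proof -
  assume "F \<noteq> {}"
  then obtain x where "x \<in> F" by blast
  then have "ennreal (1 / C * (r0 / 2)) \<le> hausdorff1 (F \<inter> cball x (r0 / 2))"
    using regular[of "r0 / 2" x] r0 by simp
  also have "\<dots> \<le> hausdorff1 F" by (rule hausdorff1_mono) simp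
  finally have "ennreal (1 / C * (r0 / 2)) \<le> hausdorff1 F" .
  moreover have "0 < ennreal (1 / C * (r0 / 2))" using C r0 by simp
  ultimately show ?thesis by (rule order_less_le_trans[rotated])
qed

text \<open>Ball \<open>i\<close> carries measure at least \<open>\<rho> i / C\<close>, and the
  disjoint balls together carry at most \<open>h\<close>.\<close>

lemma sum_radii_le:
  assumes "finite I" "\<And>i. i \<in> I \<Longrightarrow> q i \<in> F" "\<And>i. i \<in> I \<Longrightarrow> 0 < \<rho> i" "\<And>i. i \<in> I \<Longrightarrow> \<rho> i < r0"
    and disj: "\<And>i j. i \<in> I \<Longrightarrow> j \<in> I \<Longrightarrow> i \<noteq> j \<Longrightarrow> cball (q i) (\<rho> i) \<inter> cball (q j) (\<rho> j) = {}"
    and sub: "\<And>i. i \<in> I \<Longrightarrow> F \<inter> cball (q i) (\<rho> i) \<subseteq> A"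
    and A: "hausdorff1 A \<le> ennreal h" "h \<ge> 0"
  shows "(\<Sum>i\<in>I. \<rho> i) \<le> C * h"
proof -
  have "ennreal (\<Sum>i\<in>I. 1 / C * \<rho> i) = (\<Sum>i\<in>I. ennreal (1 / C * \<rho> i))"
    using assms(3) C by (subst sum_ennreal) (auto intro!: divide_nonneg_pos less_imp_le)
  also have "\<dots> \<le> (\<Sum>i\<in>I. hausdorff1 (F \<inter> cball (q i) (\<rho> i)))"
    using assms(2-4) regular by (intro sum_mono) auto
  also have "\<dots> \<le> hausdorff1 (\<Union>i\<in>I. F \<inter> cball (q i) (\<rho> i))"
    using disj by (intro sum_hausdorff1_disjoint_le assms(1) compact_Int_closed compact closed_cball) blast
  also have "\<dots> \<le> hausdorff1 A" using sub by (intro hausdorff1_mono) blast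
  also note A(1)
  finally have "(\<Sum>i\<in>I. 1 / C * \<rho> i) \<le> h" using A(2) by simp
  then have "(\<Sum>i\<in>I. \<rho> i) / C \<le> h" by (simp add: sum_divide_distrib)
  then show ?thesis using C by (simp add: divide_le_eq mult.commute)
qed

text \<open>Enlarge \<open>S\<close> to an \<open>\<eta>\<close>-separated subset of
  \<open>F\<close> of greatest cardinality. Balls of radius \<open>\<eta> / 3\<close> about
  separated points are disjoint, so the packing bound limits the cardinality, and maximality makes
  the set a net.\<close>

lemma net_exists:
  assumes S: "finite S" "S \<subseteq> F" "\<And>x y. x \<in> S \<Longrightarrow> y \<in> S \<Longrightarrow> x \<noteq> y \<Longrightarrow> \<eta> \<le> dist x y"
    and \<eta>: "0 < \<eta>" "\<eta> < r0" and h: "hausdorff1 F \<le> ennreal h" "h \<ge> 0"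
  shows "\<exists>N. finite N \<and> S \<subseteq> N \<and> N \<subseteq> F \<and> (\<forall>x\<in>N. \<forall>y\<in>N. x \<noteq> y \<longrightarrow> \<eta> \<le> dist x y) \<and>
    (\<forall>x\<in>F. \<exists>n\<in>N. dist n x < \<eta>) \<and> \<eta> * card N \<le> 3 * C * h"
proof -
  define sep where "sep N \<longleftrightarrow> finite N \<and> S \<subseteq> N \<and> N \<subseteq> F \<and> (\<forall>x\<in>N. \<forall>y\<in>N. x \<noteq> y \<longrightarrow> \<eta> \<le> dist x y)" for N
  have card: "\<eta> * card N \<le> 3 * C * h" if N: "sep N" for N
  proof -
    have "(\<Sum>x\<in>N. \<eta> / 3) \<le> C * h"
    proof (rule sum_radii_le[where q = "\<lambda>x. x" and A = F])
      show "cball x (\<eta> / 3) \<inter> cball y (\<eta> / 3) = {}" if "x \<in> N" "y \<in> N" "x \<noteq> y" for x y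
      proof -
        have "\<eta> \<le> dist x y" using N that unfolding sep_def by blast
        then have False if "dist x z \<le> \<eta> / 3" "dist y z \<le> \<eta> / 3" for z
          using that dist_triangle2[of x y z] \<eta> by linarith
        then show ?thesis by fastforce
      qed
    qed (use N \<eta> h in \<open>auto simp: sep_def\<close>)
    then show ?thesis by (simp add: algebra_simps)
  qed
  obtain K :: nat where K: "3 * C * h / \<eta> \<le> K" using real_arch_simple by blast
  have "card N < Suc K" if "sep N" for N
  proof -
    have "card N \<le> 3 * C * h / \<eta>"
      using card[OF that] \<eta>(1) by (simp add: pos_le_divide_eq mult.commute)
    then show ?thesis using K by simp
  qed
  moreover have "sep S" using S by (auto simp: sep_def)
  ultimately obtain N where N: "sep N" "\<And>N'. sep N' \<Longrightarrow> card N' \<le> card N"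
    using ex_has_greatest_nat[of sep S card "Suc K"] by blast
  have "\<exists>n\<in>N. dist n x < \<eta>" if "x \<in> F" for x
  proof (rule ccontr)
    assume *: "\<not> (\<exists>n\<in>N. dist n x < \<eta>)"
    then have "x \<notin> N" using \<eta>(1) by auto
    moreover have "sep (insert x N)"
      using N(1) * that by (auto simp: sep_def not_less dist_commute)
    ultimately show False using N(2)[of "insert x N"] N(1) by (simp add: sep_def)
  qed
  then show ?thesis using N(1) card[OF N(1)] by (intro exI[of _ N]) (simp add: sep_def)
qed

end

subsection \<open>Connecting a net through balls\<close>

text \<open>Turns reachability into an edge leaving \<open>W\<close>, the form of connectedness that
  \<open>expansive_of_connected\<close> asks for.\<close>

lemma rtrancl_exit:
  assumes "(u, w) \<in> E\<^sup>*" "u \<in> W" "w \<notin> W"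
  obtains y z where "(u, y) \<in> E\<^sup>*" "(y, z) \<in> E" "y \<in> W" "z \<notin> W"
  using assms(1,3)
proof (induction arbitrary: thesis rule: rtrancl_induct)
  case base
  then show ?case using assms(2) by blast
next
  case (step y z)
  then show ?case by (cases "y \<in> W") blast+
qed

text \<open>The points of \<open>F\<close> are sorted into classes: those in some ball follow the centre of
  the first ball containing them, the others follow a nearby net point. Distinct classes are at
  least \<open>\<eta>\<close> apart. By hypothesis \<open>greedy\<close> a separation narrower than \<open>\<delta>\<close> would have
  both its ends in one ball, so distinct classes are even \<open>\<delta>\<close> apart, and a \<open>\<delta>\<close>-net
  meets all of them.\<close>

lemma net_graph:
  fixes F N S D0 :: "'a::metric_space set" and p :: "nat \<Rightarrow> 'a" and s :: "nat \<Rightarrow> real" and m :: nat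
    and D :: real
  assumes N: "finite N" "N \<subseteq> F" "\<And>x. x \<in> F \<Longrightarrow> \<exists>n\<in>N. dist n x < \<eta>" and \<eta>: "\<eta> > 0"
    and p: "\<And>i. i < m \<Longrightarrow> p i \<in> F"
    and B: "finite B" "B \<subseteq> (N \<union> p ` {..<m}) \<times> (N \<union> p ` {..<m})"
    and cross_net: "\<And>n i. n \<in> N \<Longrightarrow> i < m \<Longrightarrow> \<bar>dist n (p i) - s i\<bar> \<le> 2 * \<eta> \<Longrightarrow> (n, p i) \<in> B"
    and cross_centre: "\<And>i j. i < j \<Longrightarrow> j < m \<Longrightarrow> \<bar>dist (p j) (p i) - s i\<bar> \<le> s j + \<eta> \<Longrightarrow> (p j, p i) \<in> B"
    and greedy: "\<And>A x y. A \<subseteq> F \<Longrightarrow> (\<And>x y. x \<in> A \<Longrightarrow> y \<in> F - A \<Longrightarrow> \<eta> \<le> dist x y) \<Longrightarrow>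
      x \<in> A \<Longrightarrow> y \<in> F - A \<Longrightarrow> dist x y < \<delta> \<Longrightarrow>
      \<exists>i<m. \<exists>x\<in>A. \<exists>y\<in>F - A. x \<in> cball (p i) (s i) \<and> y \<in> cball (p i) (s i)"
    and D0: "finite D0" "D0 \<subseteq> F" "\<And>x. x \<in> F \<Longrightarrow> \<exists>z\<in>D0. dist z x < \<delta>"
    and D: "\<And>x y. x \<in> F \<Longrightarrow> y \<in> F \<Longrightarrow> dist x y \<le> D"
    and S: "S \<subseteq> N" "S \<noteq> {}" "\<And>i. i < m \<Longrightarrow> S \<inter> cball (p i) (s i) = {}"
  shows "\<exists>V v0 B'. S \<subseteq> V \<and> V \<subseteq> N \<union> p ` {..<m} \<and> v0 \<in> V \<and> finite B' \<and>
    (\<Sum>(x, y)\<in>B'. dist x y) \<le> (\<Sum>(x, y)\<in>B. dist x y) + card D0 * D \<and>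
    (\<forall>W. v0 \<in> W \<longrightarrow> W \<subset> V \<longrightarrow>
      (\<exists>u\<in>W. \<exists>w\<in>V - W. dist u w \<le> 3 * \<eta> \<or> (u, w) \<in> B' \<or> (w, u) \<in> B'))"
proof -
  define X where "X = N \<union> p ` {..<m}"
  define E where "E = {(u, w). u \<in> N \<and> w \<in> N \<and> dist u w < 3 * \<eta> \<or> (u, w) \<in> B \<or> (w, u) \<in> B}"
  define cl where "cl u w \<longleftrightarrow> (u, w) \<in> E\<^sup>*" for u w
  have "sym E" by (auto simp: E_def sym_def dist_commute)
  then have "sym (E\<^sup>*)" by (rule sym_rtrancl)
  then have cl_sym: "cl u w \<Longrightarrow> cl w u" for u w by (auto simp: cl_def dest: symD)
  have cl_trans: "cl u w \<Longrightarrow> cl w z \<Longrightarrow> cl u z" for u w z by (auto simp: cl_def)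
  have cl_refl: "cl u u" for u by (simp add: cl_def)
  have cl_net: "cl u w" if "u \<in> N" "w \<in> N" "dist u w < 3 * \<eta>" for u w
    using that by (auto simp: cl_def E_def)
  have cl_B: "cl u w" if "(u, w) \<in> B" for u w using that by (auto simp: cl_def E_def)
  define ins where "ins x i \<longleftrightarrow> i < m \<and> x \<in> cball (p i) (s i)" for x i
  \<comment> \<open>The choice of the first ball matters: \<open>cross_centre\<close> joins two
    centres only if the ball of larger index comes near the sphere of the one of smaller
    index.\<close>
  define v where "v x = (if \<exists>i. ins x i then p (LEAST i. ins x i) else (SOME n. n \<in> N \<and> dist n x < \<eta>))" for x
  have v_in: "\<exists>i\<le>k. ins x i \<and> v x = p i \<and> (\<forall>j<i. \<not> ins x j)" if "ins x k" for x k
  proof -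
    have "v x = p (LEAST i. ins x i)" using that by (auto simp: v_def)
    then show ?thesis
      using LeastI[of "ins x", OF that] Least_le[of "ins x", OF that] not_less_Least[of _ "ins x"] by blast
  qed
  have v_out: "v x \<in> N \<and> dist (v x) x < \<eta>" if "x \<in> F" "\<not> (\<exists>i. ins x i)" for x
  proof -
    have "\<exists>n. n \<in> N \<and> dist n x < \<eta>" using N(3)[OF that(1)] by blast
    from someI_ex[OF this] show ?thesis using that(2) by (simp add: v_def)
  qed
  have v_X: "v x \<in> X" if "x \<in> F" for x
    using v_in[of x] v_out[OF that] by (fastforce simp: X_def ins_def)
  have X_F: "X \<subseteq> F" using p N(2) by (auto simp: X_def)
  have cl_X: "w \<in> X" if "cl u w" "u \<in> X" for u w
    using that unfolding cl_def
  proof (induction rule: rtrancl_induct)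
    case (step y z)
    then show ?case using B(2) by (auto simp: E_def X_def)
  qed
  \<comment> \<open>Since \<open>x\<close> is inside ball \<open>i\<close> and \<open>y\<close>
    outside it, ball \<open>j\<close> enlarged by \<open>\<eta>\<close> reaches across the sphere of
    ball \<open>i\<close>.\<close>
  have cross: "cl (p j) (p i)" if "i < j" "ins x i" "ins y j" "\<not> ins y i" "dist x y < \<eta> \<or> ins x j" for x y i j
  proof -
    have "dist (p i) x \<le> s i" "dist (p i) y > s i" "dist (p j) y \<le> s j" "j < m" "s j \<ge> 0"
      using that(1-4) by (auto simp: ins_def intro: order_trans[OF zero_le_dist])
    moreover have "dist x y < \<eta> \<or> dist (p j) x \<le> s j" using that(5) by (auto simp: ins_def)
    ultimately have "\<bar>dist (p j) (p i) - s i\<bar> \<le> s j + \<eta>"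
      using dist_triangle[of "p i" y "p j"] dist_triangle[of "p i" "p j" x] dist_triangle[of "p j" x y]
        dist_triangle[of "p j" "p i" x] dist_triangle[of "p j" "p i" y] \<eta>
      by (auto simp: dist_commute)
    then show ?thesis using cl_B cross_centre[OF that(1)] \<open>j < m\<close> by blast
  qed
  \<comment> \<open>As \<open>y\<close> is in no ball, the short step from \<open>x\<close> to
    \<open>y\<close> crosses the sphere of the first ball containing \<open>x\<close>, and
    \<open>v y\<close> is a net point next to that sphere.\<close>
  have near1: "cl (v x) (v y)" if xy: "x \<in> F" "y \<in> F" "dist x y < \<eta>" "ins x i" "\<not> (\<exists>j. ins y j)" for x y i
  proof -
    obtain i' where i': "ins x i'" "v x = p i'" using v_in[OF xy(4)] by blast
    have vy: "v y \<in> N" "dist (v y) y < \<eta>" using v_out[OF xy(2,5)] by auto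
    have "dist (p i') x \<le> s i'" "dist (p i') y > s i'" "i' < m"
      using i'(1) xy(5) by (auto simp: ins_def not_le)
    then have "\<bar>dist (v y) (p i') - s i'\<bar> \<le> 2 * \<eta>"
      using xy(3) vy(2) dist_triangle[of "p i'" y x] dist_triangle[of "p i'" y "v y"]
        dist_triangle[of "v y" "p i'" y] by (auto simp: dist_commute)
    then show ?thesis using cl_B cross_net[OF vy(1) \<open>i' < m\<close>] cl_sym i'(2) by metis
  qed
  have near2: "cl (v x) (v y)" if xy: "dist x y < \<eta>" "ins x i" "ins y j" for x y i j
  proof -
    obtain a where a: "ins x a" "v x = p a" "\<forall>k<a. \<not> ins x k" using v_in[OF xy(2)] by blast
    obtain b where b: "ins y b" "v y = p b" "\<forall>k<b. \<not> ins y k" using v_in[OF xy(3)] by blast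
    consider "a = b" | "a < b" | "b < a" by linarith
    then show ?thesis
    proof cases
      case 2
      then show ?thesis using cross[OF 2 a(1) b(1)] a(2) b xy(1) cl_sym by auto
    next
      case 3
      then show ?thesis using cross[OF 3 b(1) a(1)] a b(2) xy(1) by (auto simp: dist_commute)
    qed (use a b cl_refl in auto)
  qed
  have near: "cl (v x) (v y)" if xy: "x \<in> F" "y \<in> F" "dist x y < \<eta>" for x y
  proof (cases "\<exists>i. ins x i")
    case True
    then show ?thesis using near1[OF xy] near2[OF xy(3)] by blast
  next
    case x: False
    show ?thesis
    proof (cases "\<exists>i. ins y i")
      case True
      then show ?thesis using near1[OF xy(2,1)] x xy(3) cl_sym by (metis dist_commute)
    next
      case False
      then have "v x \<in> N" "dist (v x) x < \<eta>" "v y \<in> N" "dist (v y) y < \<eta>"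
        using v_out xy x by blast+
      moreover from this have "dist (v x) (v y) < 3 * \<eta>"
        using xy(3) dist_triangle[of "v x" "v y" x] dist_triangle[of x "v y" y]
        by (auto simp: dist_commute)
      ultimately show ?thesis using cl_net by blast
    qed
  qed
  \<comment> \<open>The common ball \<open>i\<close> need not be the first ball of either point. If
    \<open>x\<close> is in ball \<open>b\<close>, the centres \<open>p a\<close> and
    \<open>p b\<close> are joined directly; otherwise \<open>b < i\<close>, and both are joined to
    \<open>p i\<close>.\<close>
  have in_ball: "cl (v x) (v y)" if xy: "ins x i" "ins y i" "a \<le> b"
      "ins x a" "v x = p a" "\<forall>k<a. \<not> ins x k" "ins y b" "v y = p b" "\<forall>k<b. \<not> ins y k" for x y i a b
  proof (cases "a = b")
    case False
    then have ab: "a < b" using xy(3) by simp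
    then have ya: "\<not> ins y a" using xy(9) by blast
    show ?thesis
    proof (cases "ins x b")
      case True
      then show ?thesis using cross[OF ab xy(4,7) ya] xy(5,8) cl_sym by auto
    next
      case xb: False
      then have "b \<noteq> i" using xy(1) by blast
      then have bi: "b < i" using xy(2,9) by (meson linorder_neqE_nat)
      have "cl (p i) (p a)" using cross[of a i x y] ab bi xy(1,2,4) ya by simp
      moreover have "cl (p i) (p b)" using cross[OF bi xy(7,1) xb] xy(2) by blast
      ultimately show ?thesis using xy(5,8) cl_sym cl_trans by metis
    qed
  qed (use xy cl_refl in auto)
  have ball: "cl (v x) (v y)" if xy: "ins x i" "ins y i" for x y i
  proof -
    obtain a where a: "ins x a" "v x = p a" "\<forall>k<a. \<not> ins x k" using v_in[OF xy(1)] by blast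
    obtain b where b: "ins y b" "v y = p b" "\<forall>k<b. \<not> ins y k" using v_in[OF xy(2)] by blast
    show ?thesis
      using in_ball[OF xy _ a b] in_ball[OF xy(2,1) _ b a] cl_sym by (meson nat_le_linear)
  qed
  have sep: "cl (v x) (v y)" if xy: "x \<in> F" "y \<in> F" "dist x y < \<delta>" for x y
  proof (rule ccontr)
    assume not: "\<not> cl (v x) (v y)"
    define A where "A = {z \<in> F. cl (v x) (v z)}"
    have "\<exists>i<m. \<exists>x\<in>A. \<exists>y\<in>F - A. x \<in> cball (p i) (s i) \<and> y \<in> cball (p i) (s i)"
    proof (rule greedy[of A x y])
      show "\<eta> \<le> dist x' y'" if "x' \<in> A" "y' \<in> F - A" for x' y'
        using that near[of x' y'] cl_trans by (force simp: A_def not_less[symmetric])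
    qed (use xy not cl_refl in \<open>auto simp: A_def\<close>)
    then obtain i x' y' where "ins x' i" "ins y' i" "x' \<in> A" "y' \<in> F - A"
      by (auto simp: ins_def)
    then show False using ball[of x' i y'] cl_trans by (auto simp: A_def)
  qed
  obtain s0 where s0: "s0 \<in> S" using S(2) by blast
  then have "s0 \<in> F" using S(1) N(2) by blast
  then obtain d0 where d0: "d0 \<in> D0" using D0(3) by blast
  \<comment> \<open>Only vertices reachable from representatives of \<open>D0\<close> are kept. A
    star about \<open>v d0\<close> joins their classes by at most \<open>card D0\<close> edges of
    length at most \<open>D\<close>.\<close>
  define V where "V = {w \<in> X. \<exists>x\<in>D0. cl (v x) w}"
  define B' where "B' = B \<union> (\<lambda>x. (v d0, v x)) ` D0"
  have vV: "v x \<in> V" if "x \<in> D0" for x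
    using that v_X D0(2) cl_refl by (auto simp: V_def)
  show ?thesis
  proof (intro exI[of _ V] exI[of _ "v d0"] exI[of _ B'] conjI allI impI)
    show "V \<subseteq> N \<union> p ` {..<m}" by (auto simp: V_def X_def)
    show "S \<subseteq> V"
    proof
      fix x assume x: "x \<in> S"
      then have xN: "x \<in> N" and xF: "x \<in> F" using S(1) N(2) by auto
      \<comment> \<open>Outside all balls the representative of \<open>x\<close> is a net point near
        \<open>x\<close> and not a centre, so \<open>x\<close> is reached itself.\<close>
      have out: "\<not> (\<exists>i. ins x i)" unfolding ins_def using S(3) x by blast
      have "cl (v x) x" using v_out[OF xF out] cl_net[OF _ xN] \<eta> by auto
      moreover obtain z where "z \<in> D0" "dist z x < \<delta>" using D0(3)[OF xF] by blast
      moreover from this have "cl (v z) (v x)" using sep D0(2) xF by blast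
      ultimately show "x \<in> V" using xN cl_trans by (auto simp: V_def X_def)
    qed
    show "v d0 \<in> V" using vV d0 by blast
    show "finite B'" using B(1) D0(1) by (simp add: B'_def)
    have "(\<Sum>(x, y)\<in>B'. dist x y) \<le> (\<Sum>(x, y)\<in>B. dist x y) + (\<Sum>(x, y)\<in>(\<lambda>x. (v d0, v x)) ` D0. dist x y)"
      unfolding B'_def using B(1) D0(1) by (subst sum_Un) (auto intro!: sum_nonneg)
    also have "(\<Sum>(x, y)\<in>(\<lambda>x. (v d0, v x)) ` D0. dist x y) \<le> (\<Sum>x\<in>D0. dist (v d0) (v x))"
      using sum_image_le[OF D0(1), of "\<lambda>(x, y). dist x y" "\<lambda>x. (v d0, v x)"] by (simp add: comp_def)
    also have "\<dots> \<le> card D0 * D"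
      using D v_X X_F D0(2) d0 by (intro sum_bounded_above) blast
    finally show "(\<Sum>(x, y)\<in>B'. dist x y) \<le> (\<Sum>(x, y)\<in>B. dist x y) + card D0 * D" by simp
  next
    fix W assume W: "v d0 \<in> W" "W \<subset> V"
    then obtain w x where w: "w \<in> V" "w \<notin> W" "x \<in> D0" "cl (v x) w" by (auto simp: V_def)
    \<comment> \<open>If \<open>W\<close> misses the representative \<open>v x\<close>, an edge of
      the star leaves \<open>W\<close>; otherwise an edge on the path from \<open>v x\<close> to
      \<open>w\<close> does.\<close>
    show "\<exists>u\<in>W. \<exists>w\<in>V - W. dist u w \<le> 3 * \<eta> \<or> (u, w) \<in> B' \<or> (w, u) \<in> B'"
    proof (cases "v x \<in> W")
      case False
      then show ?thesis using vV[OF w(3)] W(1) w(3)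
        by (intro bexI[of _ "v d0"] bexI[of _ "v x"]) (auto simp: B'_def)
    next
      case True
      obtain y z where yz: "(v x, y) \<in> E\<^sup>*" "(y, z) \<in> E" "y \<in> W" "z \<notin> W"
        using rtrancl_exit[OF _ True w(2)] w(4) unfolding cl_def by blast
      have "cl (v x) z" using yz(1,2) by (auto simp: cl_def)
      then have "z \<in> V" using cl_X w(3) vV by (auto simp: V_def)
      then show ?thesis using yz by (intro bexI[of _ y] bexI[of _ z]) (auto simp: E_def B'_def)
    qed
  qed
qed

lemma sum_UN_le:
  fixes f :: "'a \<Rightarrow> real"
  assumes "finite I" "\<And>i. i \<in> I \<Longrightarrow> finite (A i)" "\<And>x. f x \<ge> 0"
  shows "sum f (\<Union>i\<in>I. A i) \<le> (\<Sum>i\<in>I. sum f (A i))"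
  using assms(1,2)
proof (induction I rule: finite_induct)
  case (insert i I)
  have "sum f (A i \<union> (\<Union>i\<in>I. A i)) \<le> sum f (A i) + sum f (\<Union>i\<in>I. A i)"
    using insert assms(3) by (subst sum_Un) (auto intro!: sum_nonneg)
  then show ?case using insert by force
qed simp

section \<open>Good radii and the length of the tour\<close>

context regular_compact
begin

text \<open>Net points and later centres that can come near the sphere lie in a ball of radius
  proportional to \<open>\<omega> i\<close>. Packing bounds their total tolerance by a multiple of
  \<open>\<omega> i\<close>, while the radius ranges over an interval of length at least
  \<open>\<omega> i / 2\<close>; averaging gives the constant. The factor \<open>C\<^sup>2\<close>
  comes from using both regularity bounds.\<close>

lemma crossing_radius:
  fixes p :: "nat \<Rightarrow> 'a" and \<omega> :: "nat \<Rightarrow> real"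
  assumes N: "finite N" "N \<subseteq> F" "\<And>x y. x \<in> N \<Longrightarrow> y \<in> N \<Longrightarrow> x \<noteq> y \<Longrightarrow> \<eta> \<le> dist x y" and \<eta>: "\<eta> > 0"
    and p: "\<And>j. j < m \<Longrightarrow> p j \<in> F" and \<omega>: "\<And>j. j < m \<Longrightarrow> \<eta> \<le> \<omega> j"
    and anti: "\<And>j. i < j \<Longrightarrow> j < m \<Longrightarrow> \<omega> j \<le> \<omega> i"
    and disj: "\<And>j k. j < m \<Longrightarrow> k < m \<Longrightarrow> j \<noteq> k \<Longrightarrow> cball (p j) (\<omega> j) \<inter> cball (p k) (\<omega> k) = {}"
    and i: "i < m" and b: "b \<ge> 1" "a + \<omega> i / 2 \<le> b * \<omega> i" "(2 * b + 3) * \<omega> i < r0"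
  shows "\<exists>s\<ge>a. s \<le> b * \<omega> i \<and> real (card {n \<in> N. \<bar>dist n (p i) - s\<bar> \<le> 2 * \<eta>} +
      card {j \<in> {i<..<m}. \<bar>dist (p j) (p i) - s\<bar> \<le> (b + 1) * \<omega> j}) \<le> 2 * (2 * b + 14) * (2 * b + 3) * C\<^sup>2"
proof -
  \<comment> \<open>Large enough to contain the packed balls about all points of \<open>N'\<close>
    and all centres indexed by \<open>J'\<close>.\<close>
  define T where "T = (2 * b + 3) * \<omega> i"
  have \<omega>i: "\<eta> \<le> \<omega> i" "\<omega> i > 0" using \<omega>[OF i] \<eta> by auto
  then have b\<omega>: "b * \<omega> i \<ge> \<omega> i" using b(1) by simp
  have T: "0 < T" "T < r0" "T = 2 * (b * \<omega> i) + 3 * \<omega> i"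
    using b(1,3) \<omega>i by (auto simp: T_def algebra_simps intro!: add_nonneg_pos)
  have HT: "hausdorff1 (F \<inter> cball (p i) T) \<le> ennreal (C * T)" "C * T \<ge> 0"
    using regular[OF T(1,2) p[OF i]] C T(1) by auto
  define N' where "N' = {n \<in> N. dist n (p i) \<le> b * \<omega> i + 2 * \<omega> i}"
  define J' where "J' = {j \<in> {i<..<m}. dist (p j) (p i) \<le> 2 * (b * \<omega> i) + \<omega> i}"
  \<comment> \<open>Both kinds of objects are put into one sum type, so that a single radius is good
    for both counts.\<close>
  define d where "d = case_sum (\<lambda>n. dist n (p i)) (\<lambda>j. dist (p j) (p i))"
  \<comment> \<open>The tolerance \<open>(b + 1) * \<omega> j\<close> covers every radius up to
    \<open>b * \<omega> j\<close> plus a margin \<open>\<eta> \<le> \<omega> j\<close>. Hence the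
    radii can be chosen independently of one another.\<close>
  define \<rho> where "\<rho> = case_sum (\<lambda>n :: 'a. 2 * \<eta>) (\<lambda>j. (b + 1) * \<omega> j)"
  have fin: "finite N'" "finite J'" using N(1) by (auto simp: N'_def J'_def)
  have "(\<Sum>x\<in>N'. \<eta> / 3) \<le> C * (C * T)"
  proof (rule sum_radii_le[where q = "\<lambda>x. x", OF fin(1) _ _ _ _ _ HT])
    show "cball x (\<eta> / 3) \<inter> cball y (\<eta> / 3) = {}" if "x \<in> N'" "y \<in> N'" "x \<noteq> y" for x y
    proof -
      have "\<eta> \<le> dist x y" using N(3) that unfolding N'_def by blast
      then have False if "dist x z \<le> \<eta> / 3" "dist y z \<le> \<eta> / 3" for z
        using that dist_triangle2[of x y z] \<eta> by linarith
      then show ?thesis by fastforce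
    qed
    show "F \<inter> cball x (\<eta> / 3) \<subseteq> F \<inter> cball (p i) T" if "x \<in> N'" for x
    proof -
      have "dist (p i) z \<le> T" if "dist x z \<le> \<eta> / 3" for z
        using that \<open>x \<in> N'\<close> dist_triangle[of "p i" z x] dist_commute[of "p i" x] \<omega>i(1) T(3) b\<omega> \<eta>
        unfolding N'_def mem_Collect_eq by linarith
      then show ?thesis by auto
    qed
    show "\<eta> / 3 < r0" using T(2,3) b\<omega> \<omega>i by linarith
  qed (use N(2) \<eta> in \<open>auto simp: N'_def\<close>)
  then have 1: "(\<Sum>x\<in>N'. 2 * (2 * \<eta>)) \<le> 12 * (C\<^sup>2 * T)" by (simp add: power2_eq_square algebra_simps)
  have J': "i < j" "j < m" "\<omega> j \<le> \<omega> i" "0 < \<omega> j" if "j \<in> J'" for j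
    using that anti[of j] \<omega>[of j] \<eta> by (auto simp: J'_def)
  have "(\<Sum>j\<in>J'. \<omega> j) \<le> C * (C * T)"
  proof (rule sum_radii_le[where q = p, OF fin(2) _ _ _ _ _ HT])
    show "F \<inter> cball (p j) (\<omega> j) \<subseteq> F \<inter> cball (p i) T" if "j \<in> J'" for j
    proof -
      have "dist (p i) z \<le> T" if "dist (p j) z \<le> \<omega> j" for z
        using that \<open>j \<in> J'\<close> dist_triangle[of "p i" z "p j"] dist_commute[of "p i" "p j"] T(3)
          anti[of j] \<omega>i(2)
        unfolding J'_def mem_Collect_eq greaterThanLessThan_iff by linarith
      then show ?thesis by auto
    qed
    show "\<omega> j < r0" if "j \<in> J'" for j
      using J'(3)[OF that] T(2,3) b\<omega> \<omega>i by linarith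
    show "0 < \<omega> j" if "j \<in> J'" for j using J'(4)[OF that] .
    show "cball (p j) (\<omega> j) \<inter> cball (p k) (\<omega> k) = {}" if "j \<in> J'" "k \<in> J'" "j \<noteq> k" for j k
      using disj J'(2) that by blast
  qed (use p in \<open>auto simp: J'_def\<close>)
  then have "(2 * (b + 1)) * (\<Sum>j\<in>J'. \<omega> j) \<le> (2 * (b + 1)) * (C * (C * T))"
    using b(1) by (intro mult_left_mono) auto
  moreover have "(\<Sum>j\<in>J'. 2 * ((b + 1) * \<omega> j)) = (2 * (b + 1)) * (\<Sum>j\<in>J'. \<omega> j)"
    by (simp only: sum_distrib_left mult.assoc)
  ultimately have 2: "(\<Sum>j\<in>J'. 2 * ((b + 1) * \<omega> j)) \<le> 2 * (b + 1) * (C\<^sup>2 * T)"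
    by (simp only: power2_eq_square mult.assoc)
  have ab: "a < b * \<omega> i" using b(2) \<omega>i by simp
  have \<rho>0: "\<rho> o' \<ge> 0" if "o' \<in> N' <+> J'" for o'
    using that \<eta> J'(4) b(1) by (auto simp: \<rho>_def less_imp_le)
  obtain s where s: "a \<le> s" "s \<le> b * \<omega> i"
    "card {o' \<in> N' <+> J'. \<bar>d o' - s\<bar> \<le> \<rho> o'} * (b * \<omega> i - a) \<le> (\<Sum>o'\<in>N' <+> J'. 2 * \<rho> o')"
    using averaging[OF finite_Plus[OF fin] ab, of \<rho> d] \<rho>0 by blast
  define NC where "NC = {n \<in> N. \<bar>dist n (p i) - s\<bar> \<le> 2 * \<eta>}"
  define JC where "JC = {j \<in> {i<..<m}. \<bar>dist (p j) (p i) - s\<bar> \<le> (b + 1) * \<omega> j}"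
  have NC: "NC = {n \<in> N'. \<bar>dist n (p i) - s\<bar> \<le> 2 * \<eta>}"
    using s(2) \<omega>i by (auto simp: NC_def N'_def)
  have "dist (p j) (p i) \<le> 2 * (b * \<omega> i) + \<omega> i" if "j \<in> JC" for j
  proof -
    have "(b + 1) * \<omega> j \<le> (b + 1) * \<omega> i" using that anti[of j] b(1) by (auto simp: JC_def)
    then show ?thesis using that s(2) by (auto simp: JC_def algebra_simps)
  qed
  then have JC: "JC = {j \<in> J'. \<bar>dist (p j) (p i) - s\<bar> \<le> (b + 1) * \<omega> j}"
    by (auto simp: JC_def J'_def)
  have "{o' \<in> N' <+> J'. \<bar>d o' - s\<bar> \<le> \<rho> o'} = NC <+> JC"
    by (auto simp: NC JC d_def \<rho>_def)
  then have "card {o' \<in> N' <+> J'. \<bar>d o' - s\<bar> \<le> \<rho> o'} = card NC + card JC"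
    using fin NC JC by (simp add: card_Plus)
  \<comment> \<open>Net points contribute \<open>12\<close> to the factor and centres
    \<open>2 * (b + 1)\<close>.\<close>
  moreover have "(\<Sum>o'\<in>N' <+> J'. 2 * \<rho> o') \<le> (2 * b + 14) * (C\<^sup>2 * T)"
    using 1 2 fin by (simp add: sum.Plus \<rho>_def algebra_simps)
  moreover have "real (card NC + card JC) * (\<omega> i / 2) \<le> real (card NC + card JC) * (b * \<omega> i - a)"
    using b(2) by (intro mult_left_mono) auto
  ultimately have "real (card NC + card JC) * (\<omega> i / 2) \<le> (2 * b + 14) * (C\<^sup>2 * T)"
    using s(3) by simp
  then have "real (card NC + card JC) * \<omega> i \<le> (2 * (2 * b + 14) * (2 * b + 3) * C\<^sup>2) * \<omega> i"
    by (simp add: T_def algebra_simps)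
  then have "real (card NC + card JC) \<le> 2 * (2 * b + 14) * (2 * b + 3) * C\<^sup>2"
    using \<omega>i(2) by simp
  then show ?thesis using s(1,2) unfolding NC_def JC_def by blast
qed

text \<open>The tour through one finite set. Its length bound \<open>L\<close> depends on none of
  \<open>S\<close>, \<open>\<eta>\<close> and \<open>m\<close>, as the compactness argument
  requires.\<close>

lemma finite_expansive:
  fixes p :: "nat \<Rightarrow> 'a" and \<omega> :: "nat \<Rightarrow> real" and S D0 :: "'a set" and c h D \<kappa> b :: real
  assumes S: "finite S" "S \<subseteq> F" "\<And>x y. x \<in> S \<Longrightarrow> y \<in> S \<Longrightarrow> x \<noteq> y \<Longrightarrow> \<eta> \<le> dist x y"
      "\<And>i. i < m \<Longrightarrow> S \<inter> cball (p i) (b * \<omega> i) = {}"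
    and \<eta>: "0 < \<eta>" "\<eta> < r0" and h: "hausdorff1 F \<le> ennreal h" "h \<ge> 0"
    and p: "\<And>i. i < m \<Longrightarrow> p i \<in> F" and \<omega>: "\<And>i. i < m \<Longrightarrow> \<eta> \<le> \<omega> i"
    and anti: "\<And>i j. i < j \<Longrightarrow> j < m \<Longrightarrow> \<omega> j \<le> \<omega> i"
    and disj: "\<And>j k. j < m \<Longrightarrow> k < m \<Longrightarrow> j \<noteq> k \<Longrightarrow> cball (p j) (\<omega> j) \<inter> cball (p k) (\<omega> k) = {}"
    and c: "(\<Sum>i<m. \<omega> i) \<le> c"
    and b: "b \<ge> 1" "\<kappa> + 1 / 2 \<le> b" "\<And>i. i < m \<Longrightarrow> (2 * b + 3) * \<omega> i < r0"
    and greedy: "\<And>A x y. A \<subseteq> F \<Longrightarrow> (\<And>x y. x \<in> A \<Longrightarrow> y \<in> F - A \<Longrightarrow> \<eta> \<le> dist x y) \<Longrightarrow>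
      x \<in> A \<Longrightarrow> y \<in> F - A \<Longrightarrow> dist x y < \<delta> \<Longrightarrow>
      \<exists>i<m. \<exists>x\<in>A. \<exists>y\<in>F - A. x \<in> cball (p i) (\<kappa> * \<omega> i) \<and> y \<in> cball (p i) (\<kappa> * \<omega> i)"
    and D0: "finite D0" "D0 \<subseteq> F" "\<And>x. x \<in> F \<Longrightarrow> \<exists>z\<in>D0. dist z x < \<delta>"
    and D: "\<And>x y. x \<in> F \<Longrightarrow> y \<in> F \<Longrightarrow> dist x y \<le> D"
  defines "M \<equiv> 2 * (2 * b + 14) * (2 * b + 3) * C\<^sup>2"
  defines "L \<equiv> 2 * (M * (2 * b + 2) * c + card D0 * D + 9 * C * h + 3 * c)"
  shows "\<exists>t. (\<forall>x\<in>S. t x \<in> {0..L}) \<and> (\<forall>x\<in>S. \<forall>y\<in>S. dist x y \<le> \<bar>t x - t y\<bar>)"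
proof (cases "S = {}")
  case S0: False
  have "\<exists>N. finite N \<and> S \<subseteq> N \<and> N \<subseteq> F \<and> (\<forall>x\<in>N. \<forall>y\<in>N. x \<noteq> y \<longrightarrow> \<eta> \<le> dist x y) \<and>
      (\<forall>x\<in>F. \<exists>n\<in>N. dist n x < \<eta>) \<and> \<eta> * card N \<le> 3 * C * h"
    by (rule net_exists[OF S(1,2) _ \<eta> h]) (rule S(3))
  then obtain N where N: "finite N" "S \<subseteq> N" "N \<subseteq> F" "\<And>x y. x \<in> N \<Longrightarrow> y \<in> N \<Longrightarrow> x \<noteq> y \<Longrightarrow> \<eta> \<le> dist x y"
    "\<And>x. x \<in> F \<Longrightarrow> \<exists>n\<in>N. dist n x < \<eta>" "\<eta> * card N \<le> 3 * C * h"
    by metis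
  have pos: "\<omega> i > 0" if "i < m" for i using \<omega>[OF that] \<eta>(1) by linarith
  define cr where "cr i s = real (card {n \<in> N. \<bar>dist n (p i) - s\<bar> \<le> 2 * \<eta>} +
      card {j \<in> {i<..<m}. \<bar>dist (p j) (p i) - s\<bar> \<le> (b + 1) * \<omega> j})" for i s
  have "\<exists>s\<ge>\<kappa> * \<omega> i. s \<le> b * \<omega> i \<and> cr i s \<le> M" if i: "i < m" for i
    unfolding M_def cr_def
  proof (rule crossing_radius)
    have "(\<kappa> + 1 / 2) * \<omega> i \<le> b * \<omega> i" using b(2) pos[OF i] by (intro mult_right_mono) auto
    then show "\<kappa> * \<omega> i + \<omega> i / 2 \<le> b * \<omega> i" by (simp add: algebra_simps)
  qed (fact N(1,3,4) \<eta>(1) p \<omega> anti disj i b(1) b(3)[OF i])+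
  then obtain s where s: "\<And>i. i < m \<Longrightarrow> \<kappa> * \<omega> i \<le> s i" "\<And>i. i < m \<Longrightarrow> s i \<le> b * \<omega> i"
    "\<And>i. i < m \<Longrightarrow> cr i (s i) \<le> M"
    by metis
  define NC where "NC i = {n \<in> N. \<bar>dist n (p i) - s i\<bar> \<le> 2 * \<eta>}" for i
  define JC where "JC i = {j \<in> {i<..<m}. \<bar>dist (p j) (p i) - s i\<bar> \<le> (b + 1) * \<omega> j}" for i
  define Q where "Q i = NC i \<union> p ` JC i" for i
  define B where "B = (\<Union>i<m. (\<lambda>q. (q, p i)) ` Q i)"
  have finQ: "finite (Q i)" for i using N(1) by (simp add: Q_def NC_def JC_def)
  have cardQ: "card (Q i) \<le> M" if "i < m" for i
  proof -
    have "card (Q i) \<le> card (NC i) + card (p ` JC i)" unfolding Q_def by (rule card_Un_le)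
    also have "\<dots> \<le> card (NC i) + card (JC i)" by (simp add: card_image_le JC_def)
    finally show ?thesis using s(3)[OF that] unfolding NC_def JC_def cr_def by linarith
  qed
  have distQ: "dist q (p i) \<le> (2 * b + 2) * \<omega> i" if "q \<in> Q i" "i < m" for q i
  proof -
    have "2 * \<eta> \<le> (b + 1) * \<omega> i" using \<omega>[OF that(2)] pos[OF that(2)] b(1) \<eta>(1)
      by (intro mult_mono) auto
    moreover have "(b + 1) * \<omega> j \<le> (b + 1) * \<omega> i" if "j \<in> JC i" for j
      using that anti[of i j] b(1) by (auto simp: JC_def)
    ultimately have "dist q (p i) \<le> b * \<omega> i + (b + 1) * \<omega> i"
      using that(1) s(2)[OF that(2)] by (force simp: Q_def NC_def JC_def)
    then show ?thesis using pos[OF that(2)] by (simp add: algebra_simps)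
  qed
  have M0: "M \<ge> 0" using b(1) by (auto simp: M_def)
  have sumB: "(\<Sum>(x, y)\<in>B. dist x y) \<le> M * (2 * b + 2) * c"
  proof -
    have "(\<Sum>(x, y)\<in>B. dist x y) \<le> (\<Sum>i<m. \<Sum>(x, y)\<in>(\<lambda>q. (q, p i)) ` Q i. dist x y)"
      unfolding B_def using finQ by (intro sum_UN_le) auto
    also have "\<dots> \<le> (\<Sum>i<m. M * ((2 * b + 2) * \<omega> i))"
    proof (rule sum_mono)
      fix i assume "i \<in> {..<m}"
      then have i: "i < m" by simp
      have "(\<Sum>(x, y)\<in>(\<lambda>q. (q, p i)) ` Q i. dist x y) = (\<Sum>q\<in>Q i. dist q (p i))"
        by (subst sum.reindex) (auto simp: inj_on_def)
      also have "\<dots> \<le> card (Q i) * ((2 * b + 2) * \<omega> i)"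
        using distQ[OF _ i] by (intro sum_bounded_above) blast
      also have "\<dots> \<le> M * ((2 * b + 2) * \<omega> i)"
        using cardQ[OF i] pos[OF i] b(1) by (intro mult_right_mono) auto
      finally show "(\<Sum>(x, y)\<in>(\<lambda>q. (q, p i)) ` Q i. dist x y) \<le> M * ((2 * b + 2) * \<omega> i)" .
    qed
    also have "\<dots> = M * (2 * b + 2) * (\<Sum>i<m. \<omega> i)" by (simp add: sum_distrib_left mult.assoc)
    also have "\<dots> \<le> M * (2 * b + 2) * c" using c M0 b(1) by (intro mult_left_mono) auto
    finally show ?thesis .
  qed
  have "\<exists>V v0 B'. S \<subseteq> V \<and> V \<subseteq> N \<union> p ` {..<m} \<and> v0 \<in> V \<and> finite B' \<and>
    (\<Sum>(x, y)\<in>B'. dist x y) \<le> (\<Sum>(x, y)\<in>B. dist x y) + card D0 * D \<and>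
    (\<forall>W. v0 \<in> W \<longrightarrow> W \<subset> V \<longrightarrow>
      (\<exists>u\<in>W. \<exists>w\<in>V - W. dist u w \<le> 3 * \<eta> \<or> (u, w) \<in> B' \<or> (w, u) \<in> B'))"
  proof (rule net_graph[of N F \<eta> m p B s \<delta> D0 D S])
    show "finite B" using finQ by (simp add: B_def)
    show "B \<subseteq> (N \<union> p ` {..<m}) \<times> (N \<union> p ` {..<m})"
      by (auto simp: B_def Q_def NC_def JC_def)
    show "(n, p i) \<in> B" if "n \<in> N" "i < m" "\<bar>dist n (p i) - s i\<bar> \<le> 2 * \<eta>" for n i
      using that unfolding B_def Q_def NC_def by blast
    show "(p j, p i) \<in> B" if "i < j" "j < m" "\<bar>dist (p j) (p i) - s i\<bar> \<le> s j + \<eta>" for i j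
    proof -
      \<comment> \<open>The actual radius \<open>s j\<close> stays within the tolerance used when
        \<open>s i\<close> was chosen.\<close>
      have "s j + \<eta> \<le> (b + 1) * \<omega> j" using s(2)[OF that(2)] \<omega>[OF that(2)] by (simp add: algebra_simps)
      then have "j \<in> JC i" using that by (auto simp: JC_def)
      moreover have "i < m" using that by simp
      ultimately show ?thesis unfolding B_def Q_def by blast
    qed
    show "\<exists>i<m. \<exists>x\<in>A. \<exists>y\<in>F - A. x \<in> cball (p i) (s i) \<and> y \<in> cball (p i) (s i)"
      if "A \<subseteq> F" "\<And>x y. x \<in> A \<Longrightarrow> y \<in> F - A \<Longrightarrow> \<eta> \<le> dist x y" "x \<in> A" "y \<in> F - A" "dist x y < \<delta>" for A x y
    proof -
      have "\<exists>i<m. \<exists>x\<in>A. \<exists>y\<in>F - A. x \<in> cball (p i) (\<kappa> * \<omega> i) \<and> y \<in> cball (p i) (\<kappa> * \<omega> i)"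
        by (rule greedy[of A x y]) (fact that)+
      then obtain i x' y' where i: "i < m" "x' \<in> A" "y' \<in> F - A" "x' \<in> cball (p i) (\<kappa> * \<omega> i)" "y' \<in> cball (p i) (\<kappa> * \<omega> i)"
        by blast
      have "cball (p i) (\<kappa> * \<omega> i) \<subseteq> cball (p i) (s i)" using s(1)[OF i(1)] by (intro subset_cball)
      then show ?thesis using i by blast
    qed
    show "S \<inter> cball (p i) (s i) = {}" if "i < m" for i
    proof -
      have "cball (p i) (s i) \<subseteq> cball (p i) (b * \<omega> i)" using s(2)[OF that] by (intro subset_cball)
      then show ?thesis using S(4)[OF that] by blast
    qed
  qed (fact N(1,2,3,5) \<eta>(1) p D0 D S0)+
  then obtain V v0 B' where V: "S \<subseteq> V" "V \<subseteq> N \<union> p ` {..<m}" "v0 \<in> V" "finite B'"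
    "(\<Sum>(x, y)\<in>B'. dist x y) \<le> (\<Sum>(x, y)\<in>B. dist x y) + card D0 * D"
    "\<And>W. v0 \<in> W \<Longrightarrow> W \<subset> V \<Longrightarrow>
      \<exists>u\<in>W. \<exists>w\<in>V - W. dist u w \<le> 3 * \<eta> \<or> (u, w) \<in> B' \<or> (w, u) \<in> B'"
    by metis
  have finV: "finite V" using V(2) N(1) finite_subset by blast
  have "\<exists>t. (\<forall>x\<in>V. t x \<in> {0..2 * ((\<Sum>(x, y)\<in>B'. dist x y) + 3 * \<eta> * card V)}) \<and>
      (\<forall>x\<in>V. \<forall>y\<in>V. dist x y \<le> \<bar>t x - t y\<bar>)"
  proof (rule expansive_of_connected[of V B' v0 "3 * \<eta>"])
    show "0 \<le> 3 * \<eta>" using \<eta>(1) by simp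
  qed (fact finV V(3,4,6))+
  then obtain t where t: "\<And>x. x \<in> V \<Longrightarrow> t x \<in> {0..2 * ((\<Sum>(x, y)\<in>B'. dist x y) + 3 * \<eta> * card V)}"
    "\<And>x y. x \<in> V \<Longrightarrow> y \<in> V \<Longrightarrow> dist x y \<le> \<bar>t x - t y\<bar>"
    by blast
  have "card V \<le> card N + m"
    using card_mono[OF _ V(2)] card_Un_le[of N "p ` {..<m}"] card_image_le[of "{..<m}" p] N(1) by simp
  then have "3 * \<eta> * card V \<le> 3 * \<eta> * (card N + m)" using \<eta>(1) by (intro mult_left_mono) auto
  also have "\<dots> = 3 * (\<eta> * card N) + 3 * (\<Sum>i<m. \<eta>)" by (simp add: algebra_simps)
  \<comment> \<open>The net points are paid for by the packing bound, and the centres by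
    \<open>\<eta> \<le> \<omega> i\<close>.\<close>
  also have "\<dots> \<le> 3 * (3 * C * h) + 3 * c"
    using N(6) c sum_mono[of "{..<m}" "\<lambda>_. \<eta>" \<omega>] \<omega> by simp
  finally have "3 * \<eta> * card V \<le> 9 * C * h + 3 * c" by simp
  from add_mono[OF order_trans[OF V(5) add_right_mono[OF sumB]] this]
  have "2 * ((\<Sum>(x, y)\<in>B'. dist x y) + 3 * \<eta> * card V) \<le> L"
    unfolding L_def by (intro mult_left_mono) (simp_all only: add.assoc)
  then have "{0..2 * ((\<Sum>(x, y)\<in>B'. dist x y) + 3 * \<eta> * card V)} \<subseteq> {0..L}" by simp
  then show ?thesis using t V(1) by (intro exI[of _ t]) blast
qed auto

end

subsection \<open>The greedy family has large total gap\<close>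

text \<open>Each side is \<open>F\<close> minus a union of open balls of radius
  \<open>\<eta>\<close>, hence compact, so the distance between the two sides is attained.\<close>

lemma partition_of_separated:
  fixes F :: "'a::metric_space set"
  assumes F: "compact F" and A: "A \<subseteq> F" "x \<in> A" "y \<in> F - A" and \<eta>: "\<eta> > 0"
    and sep: "\<And>x y. x \<in> A \<Longrightarrow> y \<in> F - A \<Longrightarrow> \<eta> \<le> dist x y"
  shows "\<exists>P. besicovitch_partition F P \<and> part1 P = A \<and> part2 P = F - A \<and> \<eta> \<le> gap P \<and> gap P \<le> dist x y"
proof -
  have "A = F - (\<Union>y\<in>F - A. ball y \<eta>)"
    using A(1) sep \<eta> by (force simp: dist_commute)
  then have cA: "compact A" using compact_diff[OF F] by (metis open_UN open_ball)
  have "F - A = F - (\<Union>x\<in>A. ball x \<eta>)"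
    using A(1) sep \<eta> by force
  then have cA': "compact (F - A)" using compact_diff[OF F] by (metis open_UN open_ball)
  have "\<exists>z\<in>A \<times> (F - A). \<forall>w\<in>A \<times> (F - A). dist (fst z) (snd z) \<le> dist (fst w) (snd w)"
    by (rule continuous_attains_inf)
      (use A(2,3) in \<open>auto intro!: continuous_intros compact_Times cA cA'\<close>)
  then obtain u w where uw: "u \<in> A" "w \<in> F - A"
    "\<And>x y. x \<in> A \<Longrightarrow> y \<in> F - A \<Longrightarrow> dist u w \<le> dist x y"
    by force
  have d: "setdist A (F - A) = dist u w"
  proof (rule antisym)
    show "setdist A (F - A) \<le> dist u w" using uw by (intro setdist_le_dist)
    show "dist u w \<le> setdist A (F - A)" using uw A by (intro le_setdistI) auto
  qed
  define P where "P = \<lparr>part1 = A, part2 = F - A, gap = dist u w, pt1 = u, pt2 = w\<rparr>"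
  have "dist u w > 0" using sep[OF uw(1,2)] \<eta> by linarith
  then have "besicovitch_partition F P"
    using d uw A(1) by (auto simp: besicovitch_partition_def P_def)
  then show ?thesis
    using sep[OF uw(1,2)] uw(3)[OF A(2,3)] by (intro exI[of _ P]) (simp add: P_def)
qed

text \<open>Two balls of radius at most \<open>R * gap Q\<close> meet, so their centres are at most
  \<open>2 * R * gap Q\<close> apart. Moving to the other point of either pair costs at most another
  \<open>gap Q\<close> each.\<close>

lemma not_R_disjoint_cball:
  assumes P: "besicovitch_partition F P" and Q: "besicovitch_partition F Q"
    and PQ: "\<not> R_disjoint R P Q" "gap P \<le> gap Q" "R \<ge> 0"
  shows "pt1 P \<in> cball (pt1 Q) ((2 * R + 2) * gap Q)" "pt2 P \<in> cball (pt1 Q) ((2 * R + 2) * gap Q)"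
proof -
  obtain u v z where z: "u \<in> {pt1 P, pt2 P}" "v \<in> {pt1 Q, pt2 Q}" "dist u z \<le> R * gap P" "dist v z \<le> R * gap Q"
    using PQ(1) unfolding R_disjoint_def by fastforce
  have "R * gap P \<le> R * gap Q" using PQ by (intro mult_left_mono)
  then have "dist u v \<le> 2 * (R * gap Q)" using z(3,4) dist_triangle2[of u v z] by linarith
  moreover have "dist (pt1 Q) v \<le> gap Q" "dist u (pt1 P) \<le> gap Q" "dist u (pt2 P) \<le> gap Q"
    using z(1,2) P Q PQ(2) by (auto simp: besicovitch_partition_def dist_commute)
  ultimately have "dist (pt1 Q) (pt1 P) \<le> 2 * (R * gap Q) + 2 * gap Q"
    "dist (pt1 Q) (pt2 P) \<le> 2 * (R * gap Q) + 2 * gap Q"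
    using dist_triangle[of "pt1 Q" "pt1 P" v] dist_triangle[of "pt1 Q" "pt2 P" v]
      dist_triangle[of v "pt1 P" u] dist_triangle[of v "pt2 P" u] dist_commute[of v u] by linarith+
  then show "pt1 P \<in> cball (pt1 Q) ((2 * R + 2) * gap Q)" "pt2 P \<in> cball (pt1 Q) ((2 * R + 2) * gap Q)"
    by (simp_all add: algebra_simps)
qed

lemma diameter_cball_le:
  assumes "r \<ge> 0"
  shows "diameter (cball a r) \<le> 2 * r"
proof -
  have "(SUP (x, y) \<in> cball a r \<times> cball a r. dist x y) \<le> 2 * r"
  proof (rule cSUP_least)
    fix z assume "z \<in> cball a r \<times> cball a r"
    then show "(case z of (x, y) \<Rightarrow> dist x y) \<le> 2 * r"
      using dist_triangle3[of "fst z" "snd z" a] by auto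
  qed (use assms in auto)
  then show ?thesis using assms by (simp add: diameter_def)
qed

text \<open>The sets \<open>A i\<close> cover \<open>F\<close> up to a null set, so their diameters
  bound the premeasure. The index set may be arbitrary: bounded finite sums of positive weights make
  it countable.\<close>

lemma hausdorff1_pre_le_of_null_remainder:
  fixes w :: "'i \<Rightarrow> real"
  assumes null: "hausdorff1 (F - (\<Union>i\<in>I. A i)) = 0" and \<delta>: "\<delta> > 0"
    and A: "\<And>i. i \<in> I \<Longrightarrow> bounded (A i)" "\<And>i. i \<in> I \<Longrightarrow> diameter (A i) \<le> w i"
      "\<And>i. i \<in> I \<Longrightarrow> 0 < w i" "\<And>i. i \<in> I \<Longrightarrow> w i < \<delta>"
    and c: "\<And>J. finite J \<Longrightarrow> J \<subseteq> I \<Longrightarrow> sum w J \<le> c"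
  shows "hausdorff1_pre \<delta> F \<le> ennreal c"
proof -
  have "w summable_on I"
    using A(3) c by (intro nonneg_bdd_above_summable_on) (auto simp: bdd_above_def less_imp_le)
  then have "countable {i \<in> I. w i \<noteq> 0}" by (rule summable_countable_real)
  moreover have "{i \<in> I. w i \<noteq> 0} = I" using A(3) by force
  ultimately have "countable I" by simp
  then obtain e :: "'i \<Rightarrow> nat" where e: "inj_on e I" by (rule countableE)
  \<comment> \<open>The family indexed by natural numbers: \<open>A i\<close> at
    \<open>n = e i\<close>, and empty at all \<open>n\<close> outside the range of
    \<open>e\<close>.\<close>
  define B where "B n = (\<Union>i\<in>{i \<in> I. e i = n}. A i)" for n
  have e': "{i \<in> I. e i = n} = {i}" if "i \<in> I" "e i = n" for i n
    using that e by (auto simp: inj_on_def)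
  have "F \<subseteq> (F - (\<Union>i\<in>I. A i)) \<union> (\<Union>n. B n)" by (auto simp: B_def)
  then have "hausdorff1_pre \<delta> F \<le> hausdorff1_pre \<delta> ((F - (\<Union>i\<in>I. A i)) \<union> (\<Union>n. B n))"
    by (rule hausdorff1_pre_mono)
  also have "\<dots> \<le> hausdorff1_pre \<delta> (F - (\<Union>i\<in>I. A i)) + hausdorff1_pre \<delta> (\<Union>n. B n)"
    by (rule hausdorff1_pre_Un_le[OF \<delta>])
  also have "hausdorff1_pre \<delta> (F - (\<Union>i\<in>I. A i)) = 0"
    using hausdorff1_pre_le_hausdorff1[OF \<delta>, of "F - (\<Union>i\<in>I. A i)"] null by simp
  also have "0 + hausdorff1_pre \<delta> (\<Union>n. B n) \<le> (\<Sum>n. hausdorff1_pre \<delta> (B n))"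
    using hausdorff1_pre_UN_le by simp
  also have "\<dots> \<le> ennreal c"
  proof (rule suminf_le_const)
    show "(\<Sum>n<k. hausdorff1_pre \<delta> (B n)) \<le> ennreal c" for k
    proof -
      define J where "J = {i \<in> I. e i < k}"
      have J: "finite J" "J \<subseteq> I"
        using e finite_imageD[of e J] finite_subset[of "e ` J" "{..<k}"]
        by (auto simp: J_def intro: inj_on_subset)
      have "(\<Sum>n<k. hausdorff1_pre \<delta> (B n)) \<le> (\<Sum>n<k. \<Sum>i\<in>{i \<in> J. e i = n}. ennreal (w i))"
      proof (rule sum_mono)
        fix n assume n: "n \<in> {..<k}"
        show "hausdorff1_pre \<delta> (B n) \<le> (\<Sum>i\<in>{i \<in> J. e i = n}. ennreal (w i))"
        proof (cases "\<exists>i\<in>I. e i = n")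
          case True
          then obtain i where i: "i \<in> I" "e i = n" by blast
          then have "B n = A i" "{i \<in> J. e i = n} = {i}"
            using e'[OF i] n by (auto simp: B_def J_def)
          moreover have "hausdorff1_pre \<delta> (A i) \<le> ennreal (diameter (A i))"
            using A[OF i(1)] by (intro hausdorff1_pre_le_diameter) auto
          ultimately show ?thesis
            using A(2)[OF i(1)] by (simp add: ennreal_leI order_trans)
        next
          case False
          then have "B n = {}" by (auto simp: B_def)
          then show ?thesis by (simp add: hausdorff1_pre_empty \<delta>)
        qed
      qed
      also have "\<dots> = (\<Sum>i\<in>J. ennreal (w i))"
        by (rule sum.group) (use J in \<open>auto simp: J_def\<close>)
      also have "\<dots> = ennreal (sum w J)"
        using A(3) J(2) by (intro sum_ennreal) (auto intro: less_imp_le)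
      also have "\<dots> \<le> ennreal c" using c[OF J] by (rule ennreal_leI)
      finally show ?thesis .
    qed
  qed simp
  finally show ?thesis .
qed

lemma finite_of_bounded_sums:
  fixes w :: "'i \<Rightarrow> real"
  assumes c: "\<And>J. finite J \<Longrightarrow> J \<subseteq> I \<Longrightarrow> sum w J \<le> c" and \<eta>: "\<eta> > 0"
  shows "finite {i \<in> I. \<eta> \<le> w i}"
proof (rule ccontr)
  obtain k :: nat where k: "c < k * \<eta>" using reals_Archimedean3[OF \<eta>] by blast
  assume "infinite {i \<in> I. \<eta> \<le> w i}"
  then obtain J where J: "J \<subseteq> {i \<in> I. \<eta> \<le> w i}" "finite J" "card J = k"
    using infinite_arbitrarily_large by blast
  have "k * \<eta> \<le> sum w J" using J sum_bounded_below[of J \<eta> w] by auto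
  also have "\<dots> \<le> c" using J by (intro c) auto
  finally show False using k by simp
qed

lemma enumerate_decreasing:
  fixes w :: "'i \<Rightarrow> real"
  assumes "finite I"
  shows "\<exists>f :: nat \<Rightarrow> 'i. bij_betw f {..<card I} I \<and> (\<forall>j<card I. \<forall>i<j. w (f j) \<le> w (f i))"
proof -
  obtain xs where xs: "set xs = I" "distinct xs" using finite_distinct_list[OF assms] by blast
  define ys where "ys = sort_key (\<lambda>i. - w i) xs"
  have ys: "set ys = I" "distinct ys" "sorted (map (\<lambda>i. - w i) ys)"
    using xs by (simp_all add: ys_def)
  have len: "length ys = card I" using ys(1,2) distinct_card by metis
  show ?thesis
  proof (intro exI[of _ "(!) ys"] conjI allI impI)
    show "bij_betw ((!) ys) {..<card I} I"
      by (rule bij_betw_nth) (use len ys in simp_all)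
    show "w (ys ! j) \<le> w (ys ! i)" if "i < j" "j < card I" for i j
      using sorted_nth_mono[OF ys(3), of i j] that len by simp
  qed
qed

lemma (in regular_compact) exists_finite_family:
  assumes F: "F \<noteq> {}" "purely_unrectifiable1 F" and \<epsilon>: "0 < \<epsilon>" "\<epsilon> < 1" and \<delta>: "\<delta> > 0" and R: "R \<ge> 1"
  obtains \<G> where "finite \<G>" "\<And>P. P \<in> \<G> \<Longrightarrow> besicovitch_partition F P \<and> gap P < \<delta>"
    "\<And>P Q. P \<in> \<G> \<Longrightarrow> Q \<in> \<G> \<Longrightarrow> P \<noteq> Q \<Longrightarrow> R_disjoint R P Q"
    "(1 - \<epsilon>) / (3 * (2 * R + 1)) * enn2real (hausdorff1 F) < sum gap \<G>"
proof -
  define h where "h = enn2real (hausdorff1 F)"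
  have h: "hausdorff1 F = ennreal h" "h > 0"
    using finite_hausdorff1 hausdorff1_pos[OF F(1)] by (auto simp: h_def enn2real_positive_iff)
  \<comment> \<open>Twice this value is \<open>3 * (2 * R + 1)\<close>, the denominator in the
    claim. For \<open>R \<ge> 1\<close> it exceeds \<open>\<kappa>\<close> by at least
    \<open>1 / 2\<close>, which leaves room to choose the radii.\<close>
  define b where "b = 3 * R + 3 / 2"
  define \<kappa> where "\<kappa> = 2 * R + 2"
  define c where "c = (1 - \<epsilon>) / (2 * b) * h"
  have b: "b \<ge> 1" "\<kappa> + 1 / 2 \<le> b" "2 * b = 3 * (2 * R + 1)" using R by (auto simp: b_def \<kappa>_def)
  have c: "2 * b * c = (1 - \<epsilon>) * h" "c \<ge> 0" using b(1) \<epsilon> h(2) by (auto simp: c_def)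
  have "ennreal ((1 - \<epsilon>) * h) < hausdorff1 F" using h \<epsilon> by (simp add: ennreal_lessI)
  \<comment> \<open>At scale \<open>d\<close> the premeasure already exceeds
    \<open>(1 - \<epsilon>) * h\<close>, so this much total diameter in sets smaller than
    \<open>d\<close> cannot cover \<open>F\<close>.\<close>
  then obtain d where d: "d > 0" "ennreal ((1 - \<epsilon>) * h) < hausdorff1_pre d F"
    unfolding hausdorff1_eq_SUP less_SUP_iff by auto
  \<comment> \<open>Besides the required bound on gaps, balls of radius \<open>b * gap P\<close>
    must have diameter below \<open>d\<close>, and the packing radii must stay below
    \<open>r0\<close>.\<close>
  define \<delta>' where "\<delta>' = Min {\<delta>, d / (2 * b), r0 / (2 * b + 3)}"
  have \<delta>': "\<delta>' > 0" "\<delta>' \<le> \<delta>" "\<delta>' \<le> d / (2 * b)" "\<delta>' \<le> r0 / (2 * b + 3)"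
    using \<delta> d(1) r0 b(1) by (auto simp: \<delta>'_def)
  have small: "2 * b * x < d" "(2 * b + 3) * x < r0" "x < \<delta>" if "x < \<delta>'" for x
  proof -
    have "x < d / (2 * b)" "x < r0 / (2 * b + 3)" using that \<delta>'(3,4) by linarith+
    then show "2 * b * x < d" "(2 * b + 3) * x < r0"
      using b(1) by (simp_all add: pos_less_divide_eq mult.commute)
    show "x < \<delta>" using that \<delta>'(2) by simp
  qed
  have "R \<ge> 0" using R by simp
  from greedy_family[OF compact this, of \<delta>'] obtain \<P> where
    1: "\<forall>P\<in>\<P>. besicovitch_partition F P \<and> gap P < \<delta>'" and
    2: "\<forall>P\<in>\<P>. \<forall>Q\<in>\<P>. P \<noteq> Q \<longrightarrow> R_disjoint R P Q" and
    3: "\<forall>P. besicovitch_partition F P \<longrightarrow> gap P < \<delta>' \<longrightarrow> (\<exists>Q\<in>\<P>. gap P \<le> gap Q \<and> \<not> R_disjoint R P Q)"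
    by (elim exE conjE)
  have \<P>: "\<And>P. P \<in> \<P> \<Longrightarrow> besicovitch_partition F P" "\<And>P. P \<in> \<P> \<Longrightarrow> gap P < \<delta>'"
    "\<And>P Q. P \<in> \<P> \<Longrightarrow> Q \<in> \<P> \<Longrightarrow> P \<noteq> Q \<Longrightarrow> R_disjoint R P Q"
    using 1 2 by auto
  have gap: "gap P > 0" "pt1 P \<in> F" if "P \<in> \<P>" for P
    using \<P>(1)[OF that] by (auto simp: besicovitch_partition_def)
  have "\<exists>\<G>. finite \<G> \<and> \<G> \<subseteq> \<P> \<and> c < sum gap \<G>"
  proof (rule ccontr)
    assume "\<not> ?thesis"
    then have sum: "sum gap \<G> \<le> c" if "finite \<G>" "\<G> \<subseteq> \<P>" for \<G> using that not_le by blast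
    define F0 where "F0 = F - (\<Union>P\<in>\<P>. cball (pt1 P) (b * gap P))"
    \<comment> \<open>Otherwise balls of total diameter at most \<open>2 * b * c\<close>, which is
      \<open>(1 - \<epsilon>) * h\<close>, would cover \<open>F\<close> up to a null set.\<close>
    have "hausdorff1 F0 \<noteq> 0"
    proof
      assume "hausdorff1 F0 = 0"
      then have "hausdorff1_pre d F \<le> ennreal (2 * b * c)"
        unfolding F0_def
      proof (rule hausdorff1_pre_le_of_null_remainder[where w = "\<lambda>P. 2 * b * gap P"])
        show "diameter (cball (pt1 P) (b * gap P)) \<le> 2 * b * gap P" if "P \<in> \<P>" for P
          using diameter_cball_le[of "b * gap P" "pt1 P"] gap(1)[OF that] b(1) by simp
        show "(\<Sum>P\<in>J. 2 * b * gap P) \<le> 2 * b * c" if "finite J" "J \<subseteq> \<P>" for J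
          using sum[OF that] b(1) by (simp add: sum_distrib_left[symmetric])
      qed (use gap b(1) small \<P>(2) d in auto)
      then show False using d(2) c by simp
    qed
    obtain D0 where D0: "finite D0" "D0 \<subseteq> F" "F \<subseteq> (\<Union>x\<in>D0. ball x \<delta>')"
      using compactE_image[OF compact, of F "\<lambda>x. ball x \<delta>'"] \<delta>'(1) by force
    define M where "M = 2 * (2 * b + 14) * (2 * b + 3) * C\<^sup>2"
    define L where "L = 2 * (M * (2 * b + 2) * c + card D0 * diameter F + 9 * C * h + 3 * c)"
    have "rectifiable1 F0"
    proof (rule rectifiable1_of_finite_expansive)
      have "diameter F \<ge> 0" using diameter_ge_0 compact compact_imp_bounded by blast
      then show "L \<ge> 0" using b(1) c(2) h(2) C by (auto simp: L_def M_def)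
    next
      fix S assume S: "finite S" "S \<subseteq> F0"
      \<comment> \<open>The inserted \<open>\<delta>' / 2\<close> keeps the set nonempty when
        \<open>S\<close> has at most one point, and puts \<open>\<eta>\<close> below
        \<open>\<delta>'\<close>.\<close>
      define \<eta> where "\<eta> = Min (insert (\<delta>' / 2) ((\<lambda>(x, y). dist x y) ` {(x, y) \<in> S \<times> S. x \<noteq> y}))"
      have finD: "finite ((\<lambda>(x, y). dist x y) ` {(x, y) \<in> S \<times> S. x \<noteq> y})"
        using S(1) finite_subset[of "{(x, y) \<in> S \<times> S. x \<noteq> y}" "S \<times> S"] by auto
      have \<eta>: "\<eta> > 0" "\<eta> < \<delta>'" using finD \<delta>'(1) by (auto simp: \<eta>_def Min_less_iff)
      have \<eta>S: "\<eta> \<le> dist x y" if "x \<in> S" "y \<in> S" "x \<noteq> y" for x y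
        unfolding \<eta>_def using finD that by (intro Min_le) auto
      \<comment> \<open>At resolution \<open>\<eta>\<close> only these finitely many partitions
        matter: a set at distance at least \<open>\<eta>\<close> from its complement defines a
        partition of gap at least \<open>\<eta>\<close>, and the selected partition that conflicts
        with it has no smaller gap.\<close>
      define I where "I = {P \<in> \<P>. \<eta> \<le> gap P}"
      have I: "finite I" "I \<subseteq> \<P>"
        unfolding I_def by (rule finite_of_bounded_sums, fact sum, fact \<eta>(1)) auto
      obtain f where f: "bij_betw f {..<card I} I"
        "\<And>i j. i < j \<Longrightarrow> j < card I \<Longrightarrow> gap (f j) \<le> gap (f i)"
        using enumerate_decreasing[OF I(1), of gap] by blast
      have fI: "f i \<in> I" "f i \<in> \<P>" "\<eta> \<le> gap (f i)" if "i < card I" for i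
        using f(1) that by (auto simp: bij_betw_def I_def)
      show "\<exists>t. (\<forall>x\<in>S. t x \<in> {0..L}) \<and> (\<forall>x\<in>S. \<forall>y\<in>S. dist x y \<le> \<bar>t x - t y\<bar>)"
        unfolding L_def M_def
      proof (rule finite_expansive[where p = "\<lambda>i. pt1 (f i)" and \<omega> = "\<lambda>i. gap (f i)" and m = "card I" and \<kappa> = \<kappa>])
        show "S \<subseteq> F" using S(2) by (auto simp: F0_def)
        show "S \<inter> cball (pt1 (f i)) (b * gap (f i)) = {}" if "i < card I" for i
          using S(2) fI(2)[OF that] by (auto simp: F0_def)
        have "(2 * b + 3) * \<eta> < r0" using small(2)[OF \<eta>(2)] .
        moreover have "1 * \<eta> \<le> (2 * b + 3) * \<eta>" using b(1) \<eta>(1) by (intro mult_right_mono) auto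
        ultimately show "\<eta> < r0" by simp
        show "cball (pt1 (f j)) (gap (f j)) \<inter> cball (pt1 (f k)) (gap (f k)) = {}"
          if "j < card I" "k < card I" "j \<noteq> k" for j k
        proof -
          have "f j \<noteq> f k" using f(1) that by (auto simp: bij_betw_def inj_on_def)
          then have "R_disjoint R (f j) (f k)" using \<P>(3) fI(2) that by blast
          moreover have "cball (pt1 P) (gap P) \<subseteq> cball (pt1 P) (R * gap P)" if "P \<in> \<P>" for P
            using gap(1)[OF that] R by (intro subset_cball) simp
          ultimately show ?thesis using fI(2) that unfolding R_disjoint_def by blast
        qed
        have "(\<Sum>i<card I. gap (f i)) = sum gap I" using sum.reindex_bij_betw[OF f(1)] .
        then show "(\<Sum>i<card I. gap (f i)) \<le> c" using sum[OF I] by simp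
        show "\<exists>i<card I. \<exists>x\<in>A. \<exists>y\<in>F - A. x \<in> cball (pt1 (f i)) (\<kappa> * gap (f i)) \<and> y \<in> cball (pt1 (f i)) (\<kappa> * gap (f i))"
          if A: "A \<subseteq> F" "\<And>x y. x \<in> A \<Longrightarrow> y \<in> F - A \<Longrightarrow> \<eta> \<le> dist x y" "x \<in> A" "y \<in> F - A" "dist x y < \<delta>'" for A x y
        proof -
          have ex: "\<exists>P. besicovitch_partition F P \<and> part1 P = A \<and> part2 P = F - A \<and> \<eta> \<le> gap P \<and> gap P \<le> dist x y"
            by (rule partition_of_separated[OF compact A(1,3,4) \<eta>(1)]) (rule A(2))
          obtain P where P: "besicovitch_partition F P" "part1 P = A" "part2 P = F - A" "\<eta> \<le> gap P" "gap P \<le> dist x y"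
            using ex by blast
          then have "gap P < \<delta>'" using A(5) by simp
          then obtain Q where Q: "Q \<in> \<P>" "gap P \<le> gap Q" "\<not> R_disjoint R P Q" using 3 P(1) by blast
          then have "Q \<in> I" using P(4) by (simp add: I_def)
          then have "Q \<in> f ` {..<card I}" using f(1) by (simp add: bij_betw_def)
          then obtain i where i: "i < card I" "f i = Q" by auto
          have "pt1 P \<in> A" "pt2 P \<in> F - A" using P(1-3) by (auto simp: besicovitch_partition_def)
          moreover have "pt1 P \<in> cball (pt1 (f i)) (\<kappa> * gap (f i))" "pt2 P \<in> cball (pt1 (f i)) (\<kappa> * gap (f i))"
            using not_R_disjoint_cball[OF P(1) \<P>(1)[OF Q(1)] Q(3,2) \<open>R \<ge> 0\<close>] unfolding i(2) \<kappa>_def .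
          ultimately show ?thesis using i(1) by blast
        qed
        show "\<exists>z\<in>D0. dist z x < \<delta>'" if "x \<in> F" for x using D0(3) that by force
        show "dist x y \<le> diameter F" if "x \<in> F" "y \<in> F" for x y
          using diameter_bounded_bound[OF compact_imp_bounded[OF compact] that] .
      qed (use S \<eta>S \<eta> h b f(2) fI gap D0 small(2) \<P>(2) in auto)
    qed
    then have "hausdorff1 (F \<inter> F0) = 0" using F(2) by (simp add: purely_unrectifiable1_def)
    moreover have "F \<inter> F0 = F0" by (auto simp: F0_def)
    ultimately show False using \<open>hausdorff1 F0 \<noteq> 0\<close> by simp
  qed
  then obtain \<G> where \<G>: "finite \<G>" "\<G> \<subseteq> \<P>" "c < sum gap \<G>" by blast
  show thesis
  proof (rule that[OF \<G>(1)])
    show "(1 - \<epsilon>) / (3 * (2 * R + 1)) * enn2real (hausdorff1 F) < sum gap \<G>"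
      using \<G>(3) by (simp only: c_def b(3) h_def)
    show "besicovitch_partition F P \<and> gap P < \<delta>" if "P \<in> \<G>" for P
      using \<P>(1,2) small(3) \<G>(2) that by blast
    show "R_disjoint R P Q" if "P \<in> \<G>" "Q \<in> \<G>" "P \<noteq> Q" for P Q
      using \<P>(3) \<G>(2) that by blast
  qed
qed

theorem proposition4p8:
  fixes F :: "'a::complete_space set" and r0 C \<epsilon> \<delta> R :: real
  assumes "compact F" and "F \<noteq> {}" and "purely_unrectifiable1 F"
    and "r0 > 0" and "C \<ge> 1"
    and "\<And>r x. 0 < r \<Longrightarrow> r < r0 \<Longrightarrow> x \<in> F \<Longrightarrow>
           ennreal (1 / C * r) \<le> hausdorff1 (F \<inter> cball x r) \<and>
           hausdorff1 (F \<inter> cball x r) \<le> ennreal (C * r)"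
    and "\<epsilon> > 0" and "\<delta> > 0" and "R \<ge> 1"
  shows "\<exists>(n::nat) (P :: nat \<Rightarrow> 'a bpartition).
           (\<forall>i\<in>{1..n}. besicovitch_partition F (P i)) \<and>
           (\<forall>i\<in>{1..n}. \<forall>j\<in>{1..n}. i \<noteq> j \<longrightarrow> R_disjoint R (P i) (P j)) \<and>
           (\<forall>i\<in>{1..n}. gap (P i) < \<delta>) \<and>
           ereal (\<Sum>i=1..n. gap (P i)) >
             ereal ((1 - \<epsilon>) / (3 * (2 * R + 1))) * enn2ereal (hausdorff1 F)"
proof -
  interpret regular_compact F r0 C by unfold_locales (fact assms(1,4,5,6))+
  \<comment> \<open>Reduces to a value below \<open>1\<close>, where \<open>1 - \<epsilon>'\<close>
    is positive; a smaller \<open>\<epsilon>\<close> only strengthens the claim.\<close>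
  define \<epsilon>' where "\<epsilon>' = min \<epsilon> (1 / 2)"
  have \<epsilon>': "0 < \<epsilon>'" "\<epsilon>' < 1" "\<epsilon>' \<le> \<epsilon>" using assms(7) by (auto simp: \<epsilon>'_def)
  define h where "h = enn2real (hausdorff1 F)"
  have h: "enn2ereal (hausdorff1 F) = ereal h" "h \<ge> 0"
    using finite_hausdorff1 by (auto simp: h_def) (metis enn2ereal_ennreal enn2real_nonneg ennreal_enn2real)
  obtain \<G> where \<G>: "finite \<G>" "\<And>P. P \<in> \<G> \<Longrightarrow> besicovitch_partition F P \<and> gap P < \<delta>"
    "\<And>P Q. P \<in> \<G> \<Longrightarrow> Q \<in> \<G> \<Longrightarrow> P \<noteq> Q \<Longrightarrow> R_disjoint R P Q"
    "(1 - \<epsilon>') / (3 * (2 * R + 1)) * h < sum gap \<G>"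
    unfolding h_def using exists_finite_family[OF assms(2,3) \<epsilon>'(1,2) assms(8,9)] by blast
  obtain f where f: "bij_betw f {1..card \<G>} \<G>"
    using ex_bij_betw_nat_finite_1[OF \<G>(1)] by blast
  have fG: "f i \<in> \<G>" if "i \<in> {1..card \<G>}" for i using f that by (auto simp: bij_betw_def)
  have "(1 - \<epsilon>) / (3 * (2 * R + 1)) * h \<le> (1 - \<epsilon>') / (3 * (2 * R + 1)) * h"
    using \<epsilon>'(3) assms(9) h(2) by (intro mult_right_mono divide_right_mono) auto
  also note \<G>(4)
  also have "sum gap \<G> = (\<Sum>i=1..card \<G>. gap (f i))" using sum.reindex_bij_betw[OF f, of gap] by simp
  finally have "ereal ((1 - \<epsilon>) / (3 * (2 * R + 1))) * enn2ereal (hausdorff1 F) < ereal (\<Sum>i=1..card \<G>. gap (f i))"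
    by (simp add: h(1))
  moreover have "f i \<noteq> f j" if "i \<in> {1..card \<G>}" "j \<in> {1..card \<G>}" "i \<noteq> j" for i j
    using f that unfolding bij_betw_def inj_on_def by blast
  ultimately show ?thesis using fG \<G>(2,3) by (intro exI[of _ "card \<G>"] exI[of _ f]) blast
qed

end
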